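(* If $M=(E,G)$ is a claw-free matroid, then at least one of the following holds: $M$ is even-plane; $M^c$ is triangle-free; $M$ is a strict PG-sum; or $M$ has a decomposer.
   Context: A matroid is a pair $M=(E,G)$ where $G$ is the set of nonzero vectors of a finite-dimensional $\mathbb F_2$-vector space $V(G)=G\cup\{0\}$ and $E\subseteq G$. A flat of $G$ is a set $F\subseteq G$ with $F\cup\{0\}$ a subspace; triangles and planes are flats of dimension $2$ and $3$. $M|F=(E\cap F,F)$. A claw is $(B,G)$ with $\dim G=3$, $B$ a basis; $M$ is claw-free if no $M|F$ is isomorphic (via a linear isomorphism of ambient spaces) to a claw. $M$ is even-plane if $|E\cap P|$ is even for every plane $P$. $M^c=(G\setminus E,G)$; triangle-free means the ground set contains no triangle. $M$ is full-rank if $E$ spans $V(G)$; $M$ is a strict PG-sum if it is full-rank and $E$ is the union of two disjoint nonempty flats. For a flat $F$, a coset of $F$ is a set $x+V(F)$ with $x\in G\setminus F$, where $V(F)=F\cup\{0\}$; it is mixed if it meets both $E$ and $G\setminus E$. A decomposer of $M$ is a nonempty flat $F\neq G$ having no mixed cosets. *)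

theory Defs
  imports Complex_Main "HOL-Library.Z2"
begin

text \<open>
  A matroid is a pair \<open>(E, G)\<close> of sets of vectors. The space \<open>V(G)\<close> is carried by a
  finite-dimensional subspace of an ambient \<open>\<F>\<^sub>2\<close>-vector space, so that restrictions
  to flats are again matroids over the same type.
\<close>

type_synonym 'v matroid = "'v set \<times> 'v set"

definition vspace :: "'v::zero set \<Rightarrow> 'v set" where
  "vspace F = insert 0 F"

definition restriction :: "'v matroid \<Rightarrow> 'v set \<Rightarrow> 'v matroid" where
  "restriction M F = (fst M \<inter> F, F)"

definition complement :: "'v matroid \<Rightarrow> 'v matroid" where
  "complement M = (snd M - fst M, snd M)"

definition mixed :: "'v matroid \<Rightarrow> 'v set \<Rightarrow> bool" where
  "mixed M C \<longleftrightarrow> C \<inter> fst M \<noteq> {} \<and> C \<inter> (snd M - fst M) \<noteq> {}"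

locale binary_space = vector_space scale
  for scale :: "bit \<Rightarrow> 'v::ab_group_add \<Rightarrow> 'v"
begin

definition geometry :: "'v set \<Rightarrow> bool" where
  "geometry G \<longleftrightarrow> 0 \<notin> G \<and> subspace (vspace G) \<and> (\<exists>B. finite B \<and> span B = vspace G)"

definition matroid :: "'v matroid \<Rightarrow> bool" where
  "matroid M \<longleftrightarrow> geometry (snd M) \<and> fst M \<subseteq> snd M"

definition flat :: "'v set \<Rightarrow> 'v set \<Rightarrow> bool" where
  "flat G F \<longleftrightarrow> F \<subseteq> G \<and> subspace (vspace F)"

definition triangle :: "'v set \<Rightarrow> 'v set \<Rightarrow> bool" where
  "triangle G T \<longleftrightarrow> flat G T \<and> dim (vspace T) = 2"

definition plane :: "'v set \<Rightarrow> 'v set \<Rightarrow> bool" where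
  "plane G P \<longleftrightarrow> flat G P \<and> dim (vspace P) = 3"

text \<open>
  Linearity is required only on \<open>V(G)\<close>; the values of \<open>f\<close> elsewhere are irrelevant.
\<close>

definition isomorphic :: "'v matroid \<Rightarrow> 'v matroid \<Rightarrow> bool" where
  "isomorphic M N \<longleftrightarrow>
    (\<exists>f. bij_betw f (vspace (snd M)) (vspace (snd N)) \<and>
         (\<forall>x\<in>vspace (snd M). \<forall>y\<in>vspace (snd M). f (x + y) = f x + f y) \<and>
         (\<forall>c. \<forall>x\<in>vspace (snd M). f (scale c x) = scale c (f x)) \<and>
         f ` fst M = fst N)"

definition claw :: "'v matroid \<Rightarrow> bool" where
  "claw N \<longleftrightarrow> matroid N \<and> dim (vspace (snd N)) = 3 \<and>
    independent (fst N) \<and> span (fst N) = vspace (snd N)"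

text \<open>
  Quantifying only over claws in the same type loses nothing: if \<open>M|F\<close> is isomorphic to
  a claw over some other space, then \<open>M|F\<close> is itself a claw.
\<close>

definition claw_free :: "'v matroid \<Rightarrow> bool" where
  "claw_free M \<longleftrightarrow>
    \<not> (\<exists>F N. flat (snd M) F \<and> claw N \<and> isomorphic (restriction M F) N)"

definition even_plane :: "'v matroid \<Rightarrow> bool" where
  "even_plane M \<longleftrightarrow> (\<forall>P. plane (snd M) P \<longrightarrow> even (card (fst M \<inter> P)))"

definition triangle_free :: "'v matroid \<Rightarrow> bool" where
  "triangle_free M \<longleftrightarrow> \<not> (\<exists>T. triangle (snd M) T \<and> T \<subseteq> fst M)"

definition full_rank :: "'v matroid \<Rightarrow> bool" where
  "full_rank M \<longleftrightarrow> span (fst M) = vspace (snd M)"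

definition strict_PG_sum :: "'v matroid \<Rightarrow> bool" where
  "strict_PG_sum M \<longleftrightarrow> full_rank M \<and>
    (\<exists>F\<^sub>1 F\<^sub>2. flat (snd M) F\<^sub>1 \<and> flat (snd M) F\<^sub>2 \<and> F\<^sub>1 \<noteq> {} \<and> F\<^sub>2 \<noteq> {} \<and>
             F\<^sub>1 \<inter> F\<^sub>2 = {} \<and> fst M = F\<^sub>1 \<union> F\<^sub>2)"

definition coset :: "'v set \<Rightarrow> 'v set \<Rightarrow> 'v set \<Rightarrow> bool" where
  "coset G F C \<longleftrightarrow> (\<exists>x\<in>G - F. C = (\<lambda>v. x + v) ` vspace F)"

definition decomposer :: "'v matroid \<Rightarrow> 'v set \<Rightarrow> bool" where
  "decomposer M F \<longleftrightarrow> flat (snd M) F \<and> F \<noteq> {} \<and> F \<noteq> snd M \<and>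
    (\<forall>C. coset (snd M) F C \<longrightarrow> \<not> mixed M C)"

end

end

theory Submission
  imports Defs
begin

text \<open>
  If the complement of \<open>E\<close> contains a triangle, take a maximal subspace \<open>F\<close> of \<open>V = V(G)\<close> containing it
  and disjoint from \<open>E\<close>. Claws in planes meeting \<open>F\<close> in a line are excluded, so \<open>E\<close> meets every coset
  \<open>v + F\<close> in an affine subspace, with direction \<open>stab v \<subseteq> F\<close>, say; for \<open>v\<close> outside \<open>F\<close> it is nonempty
  by maximality. Claws in planes meeting \<open>F\<close> in a point force, for any three cosets summing to zero,
  the directions \<open>A, B, C\<close> to be of one of three kinds up to order: \<open>C \<subseteq> A = B\<close>; or \<open>A = B\<close> of index two
  in \<open>C\<close>; or the three index-two subspaces between some \<open>I\<close> and \<open>S\<close> with \<open>S/I\<close> of dimension two.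

  If all directions are comparable, there is a decomposer. Otherwise consider incomparable directions
  of the largest size. The map from cosets to these directions is additive modulo a subspace \<open>Q\<close>, and
  any deviation from two rigid configurations produces a decomposer. In the first, all directions are
  \<open>F\<close> or hyperplanes of \<open>F\<close>; then the indicator function of \<open>E\<close> behaves like a quadratic form and
  claws in planes skew to \<open>F\<close> would arise from any odd plane. In the second, all directions have
  dimension at most one; then \<open>x = y \<or> x + y \<in> E\<close> is an equivalence relation on \<open>E\<close> with two classes,
  which are the two flats of a strict PG-sum.
\<close>

section \<open>Subspaces over the two-element field\<close>

context binary_space
begin

lemma add_self [simp]: "x + x = (0::'v)"
proof -
  have "scale (1 + 1) x = scale 1 x + scale 1 x"
    by (rule scale_left_distrib)
  moreover have "(1::bit) + 1 = 0"
    by simp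
  ultimately show ?thesis
    by (metis scale_one scale_zero_left)
qed

lemma add_self_left [simp]: "x + (x + y) = (y::'v)"
  by (metis add.assoc add_self add_0_left)

lemma add_self_right [simp]: "x + y + y = (x::'v)"
  by (simp add: add.assoc)

lemma add_eq_iff: "x + y = z \<longleftrightarrow> y = x + (z::'v)"
  by (metis add_self_left)

lemma add_eq_0_iff_eq [simp]: "x + y = 0 \<longleftrightarrow> x = (y::'v)"
  by (metis add_self add_self_left add_0_right)

text \<open>The only scalars are 0 and 1, so closure under addition carries all the weight.\<close>

lemma subspace_iff: "subspace A \<longleftrightarrow> 0 \<in> A \<and> (\<forall>x\<in>A. \<forall>y\<in>A. x + y \<in> A)"
proof
  assume A: "0 \<in> A \<and> (\<forall>x\<in>A. \<forall>y\<in>A. x + y \<in> A)"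
  have "scale c x \<in> A" if "x \<in> A" for c x
    using A that by (cases c) auto
  with A show "subspace A"
    by (auto simp: subspace_def)
qed (auto simp: subspace_def)

lemma subspace_add_iff:
  assumes "subspace A" "a \<in> A"
  shows "x + a \<in> A \<longleftrightarrow> x \<in> A" "a + x \<in> A \<longleftrightarrow> x \<in> A"
  using assms by (metis subspace_add add_self_left add.commute)+

section \<open>Subspaces of index two\<close>

definition index_two :: "'v set \<Rightarrow> 'v set \<Rightarrow> bool" where
  "index_two A B \<longleftrightarrow> A \<subset> B \<and> (\<forall>f\<in>B - A. \<forall>g\<in>B - A. f + g \<in> A)"

lemma index_twoD: "index_two A B \<Longrightarrow> f \<in> B \<Longrightarrow> f \<notin> A \<Longrightarrow> g \<in> B \<Longrightarrow> g \<notin> A \<Longrightarrow> f + g \<in> A"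
  by (auto simp: index_two_def)

text \<open>Translation by an element of \<open>B - A\<close> exchanges \<open>A\<close> and
  \<open>B - A\<close>.\<close>

lemma card_index_two:
  assumes "index_two A B" "subspace A" "subspace B" "finite B"
  shows "card B = 2 * card A"
proof -
  obtain f where f: "f \<in> B" "f \<notin> A"
    using assms(1) by (auto simp: index_two_def)
  have AB: "A \<subseteq> B" using assms(1) by (auto simp: index_two_def)
  have "bij_betw (\<lambda>x. f + x) A (B - A)"
  proof (rule bij_betw_byWitness[where f' = "\<lambda>x. f + x"])
    show "(\<lambda>x. f + x) ` A \<subseteq> B - A"
      using f AB assms(2,3) by (auto simp: subspace_add_iff subspace_add)
    show "(\<lambda>x. f + x) ` (B - A) \<subseteq> A"
      using f index_twoD[OF assms(1)] by auto
  qed auto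
  then have "card (B - A) = card A"
    by (metis bij_betw_same_card)
  moreover have "card B = card A + card (B - A)"
    using AB assms(4) by (metis card_Diff_subset card_mono finite_subset le_add_diff_inverse)
  ultimately show ?thesis by simp
qed

text \<open>For \<open>f\<close> in \<open>P - A\<close> and \<open>g\<close> in
  \<open>B - P\<close>, index two would put \<open>f + g\<close> into \<open>A\<close>, hence into
  \<open>P\<close>, and \<open>g\<close> with it.\<close>

lemma not_index_two_if_between:
  assumes "A \<subset> P" "P \<subset> B" "subspace P"
  shows "\<not> index_two A B"
proof
  assume "index_two A B"
  moreover obtain f g where "f \<in> P" "f \<notin> A" "g \<in> B" "g \<notin> P"
    using assms by blast
  moreover have "f + g \<in> P" using calculation assms index_twoD[of A B f g] by auto
  ultimately show False using assms(3) subspace_add_iff by blast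
qed

section \<open>Triples of directions allowed by claw-freeness\<close>

text \<open>Modulo a subspace \<open>C\<close>, everything in the union is congruent to 0 or to
  \<open>f\<close>, whichever \<open>f\<close> in \<open>A - B\<close> is taken.\<close>

definition absorbs :: "'v set \<Rightarrow> 'v set \<Rightarrow> 'v set \<Rightarrow> bool" where
  "absorbs A B C \<longleftrightarrow> (\<forall>f\<in>A - B. \<forall>g\<in>A \<union> B \<union> C. g \<in> C \<or> f + g \<in> C)"

lemma absorbsD:
  "absorbs A B C \<Longrightarrow> f \<in> A \<Longrightarrow> f \<notin> B \<Longrightarrow> g \<in> A \<union> B \<union> C \<Longrightarrow> g \<in> C \<or> f + g \<in> C"
  by (auto simp: absorbs_def)

text \<open>What claws say about the directions of three \<open>F\<close>-cosets with sum zero: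
  absorption in all six orders comes from \<open>absorbs_stab\<close>, the condition on sums from
  \<open>stab_add_in_Un\<close>.\<close>

definition tri :: "'v set \<Rightarrow> 'v set \<Rightarrow> 'v set \<Rightarrow> bool" where
  "tri A B C \<longleftrightarrow> subspace A \<and> subspace B \<and> subspace C \<and>
    absorbs A B C \<and> absorbs B A C \<and> absorbs A C B \<and> absorbs C A B \<and> absorbs B C A \<and> absorbs C B A \<and>
    (\<forall>a\<in>A. \<forall>b\<in>B. a + b \<in> A \<union> B \<union> C)"

text \<open>\<open>absorbs C B A\<close> forces \<open>C \<subseteq> B\<close>. If \<open>C\<close>
  leaves \<open>A\<close>, then \<open>absorbs B A C\<close> gives \<open>B \<subseteq> C\<close>;
  otherwise \<open>absorbs B C A\<close> gives \<open>A \<subseteq> C\<close>, and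
  \<open>absorbs B A C\<close> then says that \<open>A\<close> has index two in
  \<open>B\<close>.\<close>

lemma tri_psubset:
  assumes T: "tri A B C" and AB: "A \<subset> B"
  shows "C = B \<or> (C = A \<and> index_two A B)"
proof -
  have s: "subspace A" "subspace B" "subspace C"
    and k1: "\<And>f g. f \<in> B \<Longrightarrow> f \<notin> A \<Longrightarrow> g \<in> B \<Longrightarrow> g \<in> C \<or> f + g \<in> C"
    and k2: "\<And>f g. f \<in> C \<Longrightarrow> f \<notin> B \<Longrightarrow> g \<in> B \<Longrightarrow> g \<in> A \<or> f + g \<in> A"
    and k3: "\<And>f g. f \<in> B \<Longrightarrow> f \<notin> C \<Longrightarrow> g \<in> B \<Longrightarrow> g \<in> A \<or> f + g \<in> A"
    using T unfolding tri_def absorbs_def by blast+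
  obtain f where f: "f \<in> B" "f \<notin> A" using AB by auto
  have CB: "C \<subseteq> B"
  proof
    fix g assume "g \<in> C"
    show "g \<in> B"
    proof (rule ccontr)
      assume "g \<notin> B"
      then have "g + f \<in> A" using k2[OF \<open>g \<in> C\<close>] f by auto
      then have "g + f \<in> B" using AB by auto
      then show False using \<open>g \<notin> B\<close> f s subspace_add_iff by blast
    qed
  qed
  show ?thesis
  proof (cases "C \<subseteq> A")
    case False
    then obtain h where h: "h \<in> C" "h \<notin> A" by auto
    then have "h \<in> B" using CB by auto
    have "B \<subseteq> C" using k1[OF \<open>h \<in> B\<close> h(2)] s h subspace_add_iff by blast
    with CB show ?thesis by auto
  next
    case True
    have "A \<subseteq> C"
    proof
      fix h assume h: "h \<in> A"
      show "h \<in> C"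
      proof (rule ccontr)
        assume "h \<notin> C"
        moreover have "h \<in> B" using h AB by auto
        ultimately have "h + f \<in> A" using k3[of h f] f by auto
        then show False using h f s subspace_add_iff by blast
      qed
    qed
    with True have "C = A" by auto
    moreover have "index_two A B"
      using AB k1 \<open>C = A\<close> by (auto simp: index_two_def)
    ultimately show ?thesis by auto
  qed
qed

text \<open>Modulo \<open>A \<inter> B\<close> the three subspaces are the three lines of a
  two-dimensional space. The key is that \<open>C\<close> avoids \<open>A - B\<close> and
  \<open>B - A\<close>: a sum of one element from each must lie in some member of the triple, and
  only \<open>C\<close> is left.\<close>

lemma tri_incomparable:
  assumes T: "tri A B C" and "\<not> A \<subseteq> B" "\<not> B \<subseteq> A"
  shows "A \<inter> C = A \<inter> B" "B \<inter> C = A \<inter> B" "index_two (A \<inter> B) A" "index_two (A \<inter> B) B"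
    "index_two (A \<inter> B) C"
    and "\<And>f g. f \<in> A \<Longrightarrow> f \<notin> B \<Longrightarrow> g \<in> B \<Longrightarrow> g \<notin> A \<Longrightarrow> f + g \<in> C"
    and "C = (A \<inter> B) \<union> {f + g |f g. f \<in> A - B \<and> g \<in> B - A}"
    and "subspace (A \<union> B \<union> C)"
proof -
  have s: "subspace A" "subspace B" "subspace C"
    and ab: "absorbs A B C" "absorbs B A C" "absorbs C A B" "absorbs C B A" "absorbs A C B" "absorbs B C A"
    using T by (simp_all add: tri_def)
  note k1 = absorbsD[OF ab(1)] and k2 = absorbsD[OF ab(2)]
  have k3: "g \<in> B \<or> f + g \<in> B" if "f \<in> C" "f \<notin> A" "g \<in> A \<union> B \<union> C" for f g
    using absorbsD[OF ab(3), of f g] that by auto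
  have k4: "g \<in> A \<or> f + g \<in> A" if "f \<in> C" "f \<notin> B" "g \<in> A \<union> B \<union> C" for f g
    using absorbsD[OF ab(4), of f g] that by auto
  have k5: "g \<in> B \<or> f + g \<in> B" if "f \<in> A" "f \<notin> C" "g \<in> A \<union> B \<union> C" for f g
    using absorbsD[OF ab(5), of f g] that by auto
  have k6: "g \<in> A \<or> f + g \<in> A" if "f \<in> B" "f \<notin> C" "g \<in> A \<union> B \<union> C" for f g
    using absorbsD[OF ab(6), of f g] that by auto
  have t: "f + g \<in> A \<union> B \<union> C" if "f \<in> A" "g \<in> B" for f g
    using T that by (simp add: tri_def)
  obtain f0 g0 where fg: "f0 \<in> A" "f0 \<notin> B" "g0 \<in> B" "g0 \<notin> A" using assms by auto
  \<comment> \<open>If \<open>f\<close> were in \<open>C\<close>, then \<open>k1\<close> would put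
    \<open>g0\<close> into \<open>C\<close>, and \<open>k3\<close> applied to \<open>g0\<close>
    would put \<open>f\<close> into \<open>B\<close>.\<close>
  have nA: "f \<notin> C" if "f \<in> A" "f \<notin> B" for f
  proof
    assume "f \<in> C"
    then have "g0 \<in> C" using k1[OF that, of g0] fg s subspace_add_iff by blast
    then have "f \<in> B" using k3[of g0 f] fg \<open>f \<in> C\<close> s subspace_add_iff by blast
    with that show False by simp
  qed
  have nB: "f \<notin> C" if "f \<in> B" "f \<notin> A" for f
  proof
    assume "f \<in> C"
    then have "f0 \<in> C" using k2[OF that, of f0] fg s subspace_add_iff by blast
    then show False using nA fg by simp
  qed
  have IC: "A \<inter> B \<subseteq> C"
  proof
    fix h assume h: "h \<in> A \<inter> B"
    show "h \<in> C"
    proof (rule ccontr)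
      assume "h \<notin> C"
      then have "f0 + h \<in> C" using k1[of f0 h] fg h by auto
      moreover have "f0 + h \<in> A" "f0 + h \<notin> B" using h fg s subspace_add_iff by blast+
      ultimately show False using nA by blast
    qed
  qed
  show "A \<inter> C = A \<inter> B" "B \<inter> C = A \<inter> B" using nA nB IC by auto
  show sum: "f + g \<in> C" if "f \<in> A" "f \<notin> B" "g \<in> B" "g \<notin> A" for f g
    using t[OF that(1,3)] that s subspace_add_iff by blast
  show "index_two (A \<inter> B) A"
    unfolding index_two_def using fg nA k5 s(1) subspace_add by blast
  show "index_two (A \<inter> B) B"
    unfolding index_two_def using fg nB k6 s(2) subspace_add by blast
  have "f + g \<in> A \<inter> B" if "f \<in> C" "f \<notin> A \<inter> B" "g \<in> C" "g \<notin> A \<inter> B" for f g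
  proof -
    have "f \<notin> A" "f \<notin> B" "g \<notin> A" "g \<notin> B" using that nA nB by auto
    then show ?thesis using k3[of f g] k4[of f g] that by auto
  qed
  moreover have "f0 + g0 \<in> C" "f0 + g0 \<notin> A"
    using sum fg s subspace_add_iff by blast+
  ultimately show "index_two (A \<inter> B) C"
    unfolding index_two_def using IC by blast
  have "h \<in> (A \<inter> B) \<union> {f + g |f g. f \<in> A - B \<and> g \<in> B - A}" if h: "h \<in> C" for h
  proof (cases "h \<in> A \<or> h \<in> B")
    case True
    then show ?thesis using nA nB h by auto
  next
    case False
    have "f0 + h \<in> B" using k5[of f0 h] nA fg False h by auto
    moreover have "f0 + h \<notin> A" using False fg s subspace_add_iff by blast
    ultimately show ?thesis using fg by (intro UnI2 CollectI exI[of _ f0] exI[of _ "f0 + h"]) auto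
  qed
  then show "C = (A \<inter> B) \<union> {f + g |f g. f \<in> A - B \<and> g \<in> B - A}"
    using IC sum by blast
  \<comment> \<open>The union is \<open>A\<close> together with the single translate
    \<open>g0 + A\<close>, so closure under addition becomes four cases.\<close>
  have *: "x \<in> A \<union> B \<union> C \<longleftrightarrow> x \<in> A \<or> g0 + x \<in> A" for x
  proof
    assume "x \<in> A \<union> B \<union> C"
    then show "x \<in> A \<or> g0 + x \<in> A" using k6[of g0 x] nB fg by auto
  next
    assume "x \<in> A \<or> g0 + x \<in> A"
    then show "x \<in> A \<union> B \<union> C"
      using t[of "g0 + x" g0] fg by (auto simp: ac_simps)
  qed
  show "subspace (A \<union> B \<union> C)"
    unfolding subspace_iff
  proof (intro conjI ballI)
    show "0 \<in> A \<union> B \<union> C" using s subspace_0 by auto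
    fix x y assume "x \<in> A \<union> B \<union> C" "y \<in> A \<union> B \<union> C"
    then consider "x \<in> A" "y \<in> A" | "x \<in> A" "g0 + y \<in> A" | "g0 + x \<in> A" "y \<in> A"
      | "g0 + x \<in> A" "g0 + y \<in> A" unfolding * by blast
    then have "x + y \<in> A \<or> g0 + (x + y) \<in> A"
    proof cases
      case 2 then show ?thesis using subspace_add[OF s(1) 2] by (simp add: ac_simps)
    next
      case 3 then show ?thesis using subspace_add[OF s(1) 3] by (simp add: ac_simps)
    next
      case 4 then show ?thesis using subspace_add[OF s(1) 4] by (simp add: ac_simps)
    qed (use s subspace_add in auto)
    then show "x + y \<in> A \<union> B \<union> C" unfolding * .
  qed
qed

section \<open>Colourings that are additive modulo a subspace\<close>

text \<open>The colours behave like the nonzero vectors of the quotient of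
  \<open>Q \<union> N\<close> by \<open>Q\<close>. The main point is that translation by the sum of
  two equally coloured elements preserves every colour.\<close>

lemma colour_stabiliser:
  fixes V N :: "'v set" and c :: "'v \<Rightarrow> 'c"
  defines "Q \<equiv> {q \<in> V. \<forall>n\<in>N. q + n \<in> N \<and> c (q + n) = c n}"
  assumes V: "subspace V" "N \<subseteq> V"
    and sum: "\<And>x y. x \<in> N \<Longrightarrow> y \<in> N \<Longrightarrow> c x \<noteq> c y \<Longrightarrow> x + y \<in> N \<and> c (x + y) \<noteq> c x"
    and det: "\<And>x y x' y'. x \<in> N \<Longrightarrow> y \<in> N \<Longrightarrow> x' \<in> N \<Longrightarrow> y' \<in> N \<Longrightarrow> c x = c x' \<Longrightarrow> c y = c y' \<Longrightarrow> c x \<noteq> c y \<Longrightarrow>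
      c (x + y) = c (x' + y')"
    and two: "\<And>x. x \<in> N \<Longrightarrow> \<exists>y\<in>N. c y \<noteq> c x"
  shows "subspace Q" "Q \<inter> N = {}" "subspace (Q \<union> N)"
    and "\<And>x y. x \<in> N \<Longrightarrow> y \<in> N \<Longrightarrow> c x = c y \<Longrightarrow> x + y \<in> Q"
proof -
  have Q: "q + n \<in> N" "c (q + n) = c n" if "q \<in> Q" "n \<in> N" for q n
    using that by (auto simp: Q_def)
  \<comment> \<open>In \<open>x' + (x' + y) = y\<close> the first summand may be replaced by the
    equally coloured \<open>x\<close> without changing the colour of the sum.\<close>
  have other: "x + x' + y \<in> N \<and> c (x + x' + y) = c y"
    if x: "x \<in> N" "x' \<in> N" "c x = c x'" and y: "y \<in> N" "c y \<noteq> c x" for x x' y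
  proof -
    have 1: "x' + y \<in> N" "c (x' + y) \<noteq> c x'" using sum[of x' y] x y by auto
    have "x + (x' + y) \<in> N" using sum[of x "x' + y"] x 1 by auto
    moreover have "c (x + (x' + y)) = c (x' + (x' + y))"
      by (rule det) (use x 1 in auto)
    ultimately show ?thesis by (simp add: ac_simps)
  qed
  show same: "x + x' \<in> Q" if x: "x \<in> N" "x' \<in> N" "c x = c x'" for x x'
  proof -
    have "x + x' + y \<in> N \<and> c (x + x' + y) = c y" if y: "y \<in> N" for y
    proof (cases "c y = c x")
      case True
      \<comment> \<open>An element \<open>y\<close> of the same colour as \<open>x\<close> is the
        sum of \<open>y + z\<close> and \<open>z\<close>, two elements of other colours, to which
        \<open>other\<close> applies.\<close>
      obtain z where z: "z \<in> N" "c z \<noteq> c y" using two[OF y] by auto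
      have yz: "y + z \<in> N" "c (y + z) \<noteq> c y" "c (y + z) \<noteq> c z"
        using sum[of y z] sum[of z y] z y by (auto simp: ac_simps)
      have a: "x + x' + (y + z) \<in> N" "c (x + x' + (y + z)) = c (y + z)"
        using other[OF x yz(1)] yz True by auto
      have "x + x' + (y + z) + z \<in> N" using sum[of "x + x' + (y + z)" z] a z yz by auto
      moreover have "c (x + x' + (y + z) + z) = c (y + z + z)"
        by (rule det) (use a z yz in auto)
      ultimately show ?thesis by (simp add: ac_simps)
    qed (use other[OF x y] in auto)
    moreover have "x + x' \<in> V" using x V subspace_add by blast
    ultimately show ?thesis by (auto simp: Q_def)
  qed
  show sQ: "subspace Q"
    unfolding subspace_iff
  proof (intro conjI ballI)
    show "0 \<in> Q" using subspace_0[OF V(1)] by (simp add: Q_def)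
    show "x + y \<in> Q" if "x \<in> Q" "y \<in> Q" for x y
      using that subspace_add[OF V(1)] by (auto simp: Q_def add.assoc)
  qed
  show "Q \<inter> N = {}"
  proof (rule ccontr)
    assume "Q \<inter> N \<noteq> {}"
    then obtain q where q: "q \<in> Q" "q \<in> N" by auto
    obtain n where "n \<in> N" "c n \<noteq> c q" using two[OF q(2)] by auto
    then show False using Q[OF q(1), of n] sum[of n q] q by (auto simp: ac_simps)
  qed
  have QN: "q + n \<in> N" if "q \<in> Q" "n \<in> N" for q n using Q that by auto
  show "subspace (Q \<union> N)"
    unfolding subspace_iff
  proof (intro conjI ballI)
    show "0 \<in> Q \<union> N" using subspace_0[OF sQ] by simp
    show "x + y \<in> Q \<union> N" if "x \<in> Q \<union> N" "y \<in> Q \<union> N" for x y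
      using that QN[of x y] QN[of y x] same[of x y] sum[of x y] subspace_add[OF sQ, of x y]
      by (auto simp: ac_simps)
  qed
qed

end

section \<open>A maximal subspace disjoint from the ground set\<close>

text \<open>\<open>maximal\<close> says that every coset of \<open>F\<close> other than
  \<open>F\<close> meets \<open>E\<close>, and \<open>F_big\<close> that \<open>F\<close> has
  dimension at least two. In \<open>no_claw\<close> the three elements are independent, because 0
  lies in \<open>F\<close> and hence not in \<open>E\<close>.\<close>

locale maximal_disjoint_flat = binary_space scale
  for scale :: "bit \<Rightarrow> 'v::ab_group_add \<Rightarrow> 'v" +
  fixes V E F :: "'v set"
  assumes subspace_V: "subspace V"
    and finite_V: "finite V"
    and E_subset: "E \<subseteq> V"
    and subspace_F: "subspace F"
    and F_subset: "F \<subseteq> V"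
    and disjoint: "E \<inter> F = {}"
    and maximal: "\<And>v. v \<in> V \<Longrightarrow> v \<notin> F \<Longrightarrow> \<exists>e\<in>E. e + v \<in> F"
    and F_neq_V: "F \<noteq> V"
    and F_big: "\<exists>a\<in>F. \<exists>b\<in>F. a \<noteq> 0 \<and> b \<noteq> 0 \<and> a \<noteq> b"
    and no_claw: "\<And>x y z. x \<in> E \<Longrightarrow> y \<in> E \<Longrightarrow> z \<in> E \<Longrightarrow> x \<noteq> y \<Longrightarrow> x \<noteq> z \<Longrightarrow> y \<noteq> z \<Longrightarrow> z \<noteq> x + y \<Longrightarrow>
      x + y \<in> E \<or> x + z \<in> E \<or> y + z \<in> E \<or> x + y + z \<in> E"
begin

text \<open>\<open>D\<close> plays the part of \<open>V(F)\<close> for a decomposer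
  \<open>F\<close>, so it contains 0; invariance under translation by \<open>D\<close> expresses
  that no coset is mixed.\<close>

definition is_decomposer :: "'v set \<Rightarrow> bool" where
  "is_decomposer D \<longleftrightarrow> subspace D \<and> D \<subseteq> V \<and> D \<noteq> V \<and> D \<noteq> {0} \<and>
    (\<forall>x\<in>V - D. \<forall>d\<in>D. x + d \<in> E \<longleftrightarrow> x \<in> E)"

lemma F_V: "x \<in> F \<Longrightarrow> x \<in> V" and E_V: "x \<in> E \<Longrightarrow> x \<in> V"
  using F_subset E_subset by auto

lemma V_add [simp]: "x \<in> V \<Longrightarrow> y \<in> V \<Longrightarrow> x + y \<in> V"
  using subspace_V subspace_add by blast

lemma F_add [simp]: "x \<in> F \<Longrightarrow> y \<in> F \<Longrightarrow> x + y \<in> F"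
  using subspace_F subspace_add by blast

lemma zero_F [simp]: "0 \<in> F"
  using subspace_F subspace_0 by blast

lemma F_add_iff: "a \<in> F \<Longrightarrow> x + a \<in> F \<longleftrightarrow> x \<in> F" "a \<in> F \<Longrightarrow> a + x \<in> F \<longleftrightarrow> x \<in> F"
  using subspace_F subspace_add_iff by blast+

lemma E_not_F: "e \<in> E \<Longrightarrow> e \<notin> F"
  using disjoint by auto

lemma F_cong: "v + w \<in> F \<Longrightarrow> x + v \<in> F \<longleftrightarrow> x + w \<in> F"
  using F_add_iff(1)[of "v + w" "x + v"] by (simp add: ac_simps)

text \<open>For \<open>e \<in> E\<close> in the coset \<open>v + F\<close>, the set \<open>E \<inter> (v + F)\<close> is the affine subspace \<open>e + stab v\<close>.\<close>

definition stab :: "'v \<Rightarrow> 'v set" where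
  "stab v = {f \<in> F. \<forall>e\<in>E. e + v \<in> F \<longrightarrow> e + f \<in> E}"

lemma stab_subset: "stab v \<subseteq> F"
  by (auto simp: stab_def)

lemma finite_stab: "finite (stab v)"
  using finite_V F_subset stab_subset finite_subset by metis

lemma stab_cong: "v + w \<in> F \<Longrightarrow> stab v = stab w"
  using F_cong by (auto simp: stab_def)

lemma stab_add_F: "f \<in> F \<Longrightarrow> stab (v + f) = stab v"
  by (rule stab_cong) (simp add: ac_simps)

text \<open>If \<open>e + f\<close> is in \<open>E\<close> but \<open>e' + f\<close> is not, then
  \<open>e\<close>, \<open>e + f\<close>, \<open>e'\<close> form a claw: the sum of all three is
  \<open>e' + f\<close>, and the three pairwise sums lie in \<open>F\<close>. So one point of the
  coset decides membership in the direction.\<close>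

lemma stab_iff:
  assumes e: "e \<in> E" "e + v \<in> F" and f: "f \<in> F"
  shows "f \<in> stab v \<longleftrightarrow> e + f \<in> E"
proof
  assume ef: "e + f \<in> E"
  have "e' + f \<in> E" if e': "e' \<in> E" "e' + v \<in> F" for e'
  proof (rule ccontr)
    assume n: "e' + f \<notin> E"
    have g: "e + e' \<in> F" using F_add[OF e(2) e'(2)] by (simp add: ac_simps)
    have gf: "e + e' + f \<in> F" using g f by simp
    have "e' \<noteq> e" "e' \<noteq> e + f" "f \<noteq> 0" "e' \<noteq> f" using n ef e e' f E_not_F by (auto simp: ac_simps)
    then have "e + (e + f) \<in> E \<or> e + e' \<in> E \<or> e + f + e' \<in> E \<or> e + (e + f) + e' \<in> E"
      by (intro no_claw) (use ef e e' in \<open>auto simp: add_eq_iff ac_simps\<close>)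
    then show False using n f g gf E_not_F by (auto simp: ac_simps)
  qed
  then show "f \<in> stab v" using f by (auto simp: stab_def)
qed (use assms in \<open>auto simp: stab_def\<close>)

lemma stab_E: "e \<in> E \<Longrightarrow> f \<in> F \<Longrightarrow> f \<in> stab e \<longleftrightarrow> e + f \<in> E"
  by (rule stab_iff) auto

text \<open>An element of \<open>stab v\<close> moves points of \<open>E\<close> in the coset to
  such points again, so a second element can be applied after the first. Maximality supplies a point
  to start from.\<close>

lemma subspace_stab:
  assumes "v \<in> V" "v \<notin> F"
  shows "subspace (stab v)"
proof -
  obtain e where e: "e \<in> E" "e + v \<in> F" using maximal assms by auto
  note iff = stab_iff[OF e]
  show ?thesis
    unfolding subspace_iff
  proof (intro conjI ballI)
    show "0 \<in> stab v" using iff[of 0] e by auto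
    fix f g assume fg: "f \<in> stab v" "g \<in> stab v"
    then have F: "f \<in> F" "g \<in> F" using stab_subset by auto
    then have "e + f \<in> E" using fg iff by auto
    moreover have "e + f + v \<in> F" using F_add[OF e(2) F(1)] by (simp add: ac_simps)
    ultimately have "e + f + g \<in> E" using fg by (auto simp: stab_def)
    then show "f + g \<in> stab v" using iff[of "f + g"] F by (auto simp: ac_simps)
  qed
qed

section \<open>Directions of three cosets with sum zero\<close>

text \<open>Adding the total to one of the three elements gives the sum of the other two. If the
  total were in no direction, no pairwise sum would be in \<open>E\<close>, and the total itself is
  in \<open>F\<close>: a claw.\<close>

lemma sum_in_Un_stab:
  assumes E: "e1 \<in> E" "e2 \<in> E" "e3 \<in> E" and F: "e1 + e2 + e3 \<in> F"
  shows "e1 + e2 + e3 \<in> stab e1 \<union> stab e2 \<union> stab e3"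
proof (rule ccontr)
  assume n: "e1 + e2 + e3 \<notin> stab e1 \<union> stab e2 \<union> stab e3"
  have 1: "e2 + e3 \<notin> E" using n stab_E[OF E(1) F] by (auto simp: ac_simps)
  have 2: "e1 + e3 \<notin> E" using n stab_E[OF E(2) F] by (auto simp: ac_simps)
  have 3: "e1 + e2 \<notin> E" using n stab_E[OF E(3) F] by (auto simp: ac_simps)
  have 4: "e1 + e2 + e3 \<notin> E" using F E_not_F by auto
  have d: "e1 \<noteq> e2" "e1 \<noteq> e3" "e2 \<noteq> e3" using F E E_not_F by (auto simp: ac_simps)
  have "e3 \<noteq> e1 + e2" using 3 E by auto
  then show False using no_claw[OF E d] 1 2 3 4 by auto
qed

text \<open>The candidate claw is \<open>e1\<close>, \<open>e1 + f\<close>, \<open>e2\<close>. Its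
  total \<open>e2 + f\<close> and the sum \<open>f\<close> are outside \<open>E\<close>, so
  \<open>e1 + e2\<close> or \<open>e1 + e2 + f\<close> is in \<open>E\<close>; both lie in the coset
  of \<open>e3\<close>.\<close>

lemma add_in_stab:
  assumes E: "e1 \<in> E" "e2 \<in> E" "e3 \<in> E" and F: "e1 + e2 + e3 \<in> F"
    and f: "f \<in> stab e1" "f \<notin> stab e2"
  shows "e1 + e2 + e3 \<in> stab e3 \<or> f + (e1 + e2 + e3) \<in> stab e3"
proof -
  have fF: "f \<in> F" using f stab_subset by auto
  have e: "e1 + f \<in> E" "e2 + f \<notin> E" using f E fF stab_E by auto
  have n12: "e1 + e2 \<notin> F" using F_add_iff(2)[of "e1 + e2" e3] F E E_not_F by auto
  then have d: "e1 \<noteq> e2" "e1 + f \<noteq> e2" "f \<noteq> 0" using fF e E by (auto simp: ac_simps)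
  have "e1 + (e1 + f) \<in> E \<or> e1 + e2 \<in> E \<or> e1 + f + e2 \<in> E \<or> e1 + (e1 + f) + e2 \<in> E"
    by (rule no_claw) (use E e d fF E_not_F in \<open>auto simp: add_eq_iff ac_simps\<close>)
  then have "e1 + e2 \<in> E \<or> e1 + e2 + f \<in> E"
    using e fF E_not_F by (auto simp: ac_simps)
  then have "e3 + (e1 + e2 + e3) \<in> E \<or> e3 + (f + (e1 + e2 + e3)) \<in> E"
    by (auto simp: ac_simps)
  moreover have "f + (e1 + e2 + e3) \<in> F" using fF F by simp
  ultimately show ?thesis using stab_E[OF E(3)] F by metis
qed

text \<open>\<open>s\<close> is the sum of one point of \<open>E\<close> from each coset. Moving
  these points along their directions changes \<open>s\<close> by \<open>a + b + c\<close>, so the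
  two preceding lemmas apply to every such shift.\<close>

lemma obtain_shift:
  assumes "v \<in> V" "w \<in> V" "v \<notin> F" "w \<notin> F" "v + w \<notin> F"
  obtains s where
    "\<And>a b c. a \<in> stab v \<Longrightarrow> b \<in> stab w \<Longrightarrow> c \<in> stab (v + w) \<Longrightarrow>
      s + (a + b + c) \<in> stab v \<union> stab w \<union> stab (v + w)"
    "\<And>a b c f. a \<in> stab v \<Longrightarrow> b \<in> stab w \<Longrightarrow> c \<in> stab (v + w) \<Longrightarrow> f \<in> stab v \<Longrightarrow> f \<notin> stab w \<Longrightarrow>
      s + (a + b + c) \<in> stab (v + w) \<or> f + (s + (a + b + c)) \<in> stab (v + w)"
proof -
  obtain e1 e2 e3 where e: "e1 \<in> E" "e1 + v \<in> F" "e2 \<in> E" "e2 + w \<in> F" "e3 \<in> E" "e3 + (v + w) \<in> F"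
    using maximal assms V_add by metis
  have "(e1 + v) + (e2 + w) + (e3 + (v + w)) \<in> F" using e F_add by blast
  then have F: "e1 + e2 + e3 \<in> F" by (simp add: ac_simps)
  have st: "stab e1 = stab v" "stab e2 = stab w" "stab e3 = stab (v + w)"
    using e stab_cong by auto
  show thesis
  proof (rule that[of "e1 + e2 + e3"])
    fix a b c assume abc: "a \<in> stab v" "b \<in> stab w" "c \<in> stab (v + w)"
    then have abcF: "a \<in> F" "b \<in> F" "c \<in> F" using stab_subset by auto
    have E': "e1 + a \<in> E" "e2 + b \<in> E" "e3 + c \<in> E"
      using stab_E[OF e(1) abcF(1)] stab_E[OF e(3) abcF(2)] stab_E[OF e(5) abcF(3)] abc st by auto
    have st': "stab (e1 + a) = stab v" "stab (e2 + b) = stab w" "stab (e3 + c) = stab (v + w)"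
      using abcF st stab_add_F by auto
    have eq: "e1 + e2 + e3 + (a + b + c) = e1 + a + (e2 + b) + (e3 + c)"
      by (simp add: ac_simps)
    have F': "e1 + a + (e2 + b) + (e3 + c) \<in> F"
      unfolding eq[symmetric] using F abcF F_add by blast
    show "e1 + e2 + e3 + (a + b + c) \<in> stab v \<union> stab w \<union> stab (v + w)"
      unfolding eq using sum_in_Un_stab[OF E' F'] st' by simp
    show "e1 + e2 + e3 + (a + b + c) \<in> stab (v + w) \<or> f + (e1 + e2 + e3 + (a + b + c)) \<in> stab (v + w)"
      if "f \<in> stab v" "f \<notin> stab w" for f
      unfolding eq using add_in_stab[OF E' F', of f] st' that by simp
  qed
qed

text \<open>The shift \<open>s\<close> itself lies in one of the directions and can be cancelled
  there.\<close>

lemma stab_add_in_Un: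
  assumes vw: "v \<in> V" "w \<in> V" "v \<notin> F" "w \<notin> F" "v + w \<notin> F"
    and ab: "a \<in> stab v" "b \<in> stab w"
  shows "a + b \<in> stab v \<union> stab w \<union> stab (v + w)"
proof -
  have sub: "subspace (stab v)" "subspace (stab w)" "subspace (stab (v + w))"
    using subspace_stab vw by auto
  note zero = subspace_0[OF sub(1)] subspace_0[OF sub(2)] subspace_0[OF sub(3)]
  obtain s where s: "\<And>a b c. a \<in> stab v \<Longrightarrow> b \<in> stab w \<Longrightarrow> c \<in> stab (v + w) \<Longrightarrow>
      s + (a + b + c) \<in> stab v \<union> stab w \<union> stab (v + w)"
    using obtain_shift[OF vw] by metis
  have "s \<in> stab v \<union> stab w \<union> stab (v + w)" using s[OF zero] by simp
  then consider "s \<in> stab v" | "s \<in> stab w" | "s \<in> stab (v + w)" by blast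
  then show ?thesis
  proof cases
    case 1
    show ?thesis using s[OF subspace_add[OF sub(1) 1 ab(1)] ab(2) zero(3)] by (simp add: ac_simps)
  next
    case 2
    show ?thesis using s[OF ab(1) subspace_add[OF sub(2) 2 ab(2)] zero(3)] by (simp add: ac_simps)
  next
    case 3
    show ?thesis using s[OF ab 3] by (simp add: ac_simps)
  qed
qed

text \<open>Applying the shift property once with zeros and once with \<open>g\<close>, then adding
  the two memberships, eliminates \<open>s\<close>.\<close>

lemma absorbs_stab:
  assumes vw: "v \<in> V" "w \<in> V" "v \<notin> F" "w \<notin> F" "v + w \<notin> F"
  shows "absorbs (stab v) (stab w) (stab (v + w))"
  unfolding absorbs_def
proof (intro ballI)
  fix f g assume f: "f \<in> stab v - stab w" and g: "g \<in> stab v \<union> stab w \<union> stab (v + w)"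
  have sub: "subspace (stab v)" "subspace (stab w)" "subspace (stab (v + w))"
    using subspace_stab vw by auto
  note zero = subspace_0[OF sub(1)] subspace_0[OF sub(2)] subspace_0[OF sub(3)]
  obtain s where s: "\<And>a b c. a \<in> stab v \<Longrightarrow> b \<in> stab w \<Longrightarrow> c \<in> stab (v + w) \<Longrightarrow>
      s + (a + b + c) \<in> stab (v + w) \<or> f + (s + (a + b + c)) \<in> stab (v + w)"
    using obtain_shift[OF vw] f by (metis DiffE)
  have 1: "s \<in> stab (v + w) \<or> f + s \<in> stab (v + w)" using s[OF zero] by simp
  have 2: "s + g \<in> stab (v + w) \<or> f + (s + g) \<in> stab (v + w)"
    using g s[OF _ zero(2,3), of g] s[OF zero(1) _ zero(3), of g] s[OF zero(1,2), of g] by auto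
  show "g \<in> stab (v + w) \<or> f + g \<in> stab (v + w)"
    using 1 2 subspace_add[OF sub(3), of s "s + g"] subspace_add[OF sub(3), of "f + s" "s + g"]
      subspace_add[OF sub(3), of s "f + (s + g)"] subspace_add[OF sub(3), of "f + s" "f + (s + g)"]
    by (auto simp: ac_simps)
qed

lemma tri_stab:
  assumes vw: "v \<in> V" "w \<in> V" "v \<notin> F" "w \<notin> F" "v + w \<notin> F"
  shows "tri (stab v) (stab w) (stab (v + w))"
proof -
  have [simp]: "w + v = v + w" "w + (v + w) = v" by (simp_all add: ac_simps)
  have V: "v + w \<in> V" using vw by simp
  show ?thesis
    unfolding tri_def
    using absorbs_stab[OF vw] absorbs_stab[of w v] absorbs_stab[of v "v + w"]
      absorbs_stab[of w "v + w"] absorbs_stab[of "v + w" v] absorbs_stab[of "v + w" w]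
      stab_add_in_Un[OF vw] subspace_stab vw V
    by (simp add: ac_simps)
qed

text \<open>The cosets of the decomposer \<open>D\<close> outside \<open>X\<close> meet the \<open>F\<close>-cosets \<open>v + F\<close> and \<open>v + x + F\<close>
  alike, since the shift between them is absorbed by \<open>stab v = stab (v + x)\<close>.\<close>

lemma decomposerI:
  assumes X: "subspace X" "F \<subseteq> X" "X \<subseteq> V" and L: "subspace L" "L \<subseteq> F"
    and inside: "\<And>x. x \<in> X \<Longrightarrow> x \<notin> F \<Longrightarrow> stab x \<subseteq> L"
    and outside: "\<And>v. v \<in> V \<Longrightarrow> v \<notin> X \<Longrightarrow> L \<subseteq> stab v"
    and stab_eq: "\<And>v x. v \<in> V \<Longrightarrow> v \<notin> X \<Longrightarrow> x \<in> X \<Longrightarrow> stab (v + x) = stab v"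
    and proper: "L \<noteq> F \<or> X \<noteq> V" and nontriv: "L \<noteq> {0} \<or> X \<noteq> F"
  shows "\<exists>D. is_decomposer D"
proof
  \<comment> \<open>Inside \<open>X\<close> the points of \<open>E\<close> in an
    \<open>F\<close>-coset lie in a single \<open>L\<close>-coset. \<open>D\<close> picks out that
    \<open>L\<close>-coset in every \<open>F\<close>-coset of \<open>X\<close>, and \<open>L\<close>
    itself in \<open>F\<close>.\<close>
  define D where "D = L \<union> {x + l |x l. x \<in> E \<inter> X \<and> l \<in> L}"
  have D_iff: "d \<in> D \<longleftrightarrow> d \<in> L \<or> (\<exists>l\<in>L. d + l \<in> E \<inter> X)" for d
  proof
    assume "d \<in> D"
    then consider "d \<in> L" | x l where "x \<in> E \<inter> X" "l \<in> L" "d = x + l"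
      by (auto simp: D_def)
    then show "d \<in> L \<or> (\<exists>l\<in>L. d + l \<in> E \<inter> X)"
    proof cases
      case 2
      then have "d + l = x" by (simp add: ac_simps)
      with 2 show ?thesis by (intro disjI2 bexI[of _ l]) auto
    qed auto
  next
    assume "d \<in> L \<or> (\<exists>l\<in>L. d + l \<in> E \<inter> X)"
    moreover have "d = (d + l) + l" for l by (simp add: ac_simps)
    ultimately show "d \<in> D" unfolding D_def by blast
  qed
  have LX: "L \<subseteq> X" using L X by auto
  have L_add: "l + l' \<in> L" if "l \<in> L" "l' \<in> L" for l l' using that L subspace_add by blast
  have X_add: "l + l' \<in> X" if "l \<in> X" "l' \<in> X" for l l' using that X subspace_add by blast
  have D_X: "D \<subseteq> X" using LX X_add by (auto simp: D_def)
  have key: "x + y \<in> D" if x: "x \<in> E" "x \<in> X" and y: "y \<in> E" "y \<in> X" for x y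
  proof (cases "x + y \<in> F")
    case True
    then have "x + y \<in> stab x" using stab_E[of x "x + y"] x y by simp
    then show ?thesis using inside[OF x(2)] x E_not_F by (auto simp: D_def)
  next
    case False
    have xyX: "x + y \<in> X" using x y X_add by auto
    then obtain e where e: "e \<in> E" "e + (x + y) \<in> F" using maximal[OF _ False] X by auto
    have "e + (x + y) + (x + y) \<in> X" using e X xyX X_add by blast
    then have eX: "e \<in> X" by (simp add: ac_simps)
    \<comment> \<open>The difference between \<open>x + y\<close> and a point \<open>e\<close> of
      \<open>E\<close> in its coset lies in one of three directions, all contained in
      \<open>L\<close>.\<close>
    have "x + y + e \<in> stab x \<union> stab y \<union> stab e"
      using sum_in_Un_stab[of x y e] x y e by (simp add: ac_simps)
    then have "x + y + e \<in> L" using inside x y e eX E_not_F by blast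
    moreover have "x + y = e + (x + y + e)" by (simp add: ac_simps)
    ultimately show ?thesis unfolding D_def using e eX by blast
  qed
  have D_L: "d + l \<in> D" if "d \<in> D" "l \<in> L" for d l
  proof -
    consider "d \<in> L" | x l' where "x \<in> E \<inter> X" "l' \<in> L" "d = x + l'"
      using \<open>d \<in> D\<close> by (auto simp: D_def)
    then show ?thesis
    proof cases
      case 2
      then have "d + l = x + (l' + l)" by (simp add: add.assoc)
      then show ?thesis unfolding D_def using 2 L_add[of l' l] that by blast
    qed (use that L_add in \<open>auto simp: D_def\<close>)
  qed
  have subD: "subspace D"
    unfolding subspace_iff
  proof (intro conjI ballI)
    show "0 \<in> D" using subspace_0[OF L(1)] by (simp add: D_def)
    fix x y assume x: "x \<in> D" and y: "y \<in> D"
    show "x + y \<in> D"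
    proof (cases "x \<in> L \<or> y \<in> L")
      case True
      then show ?thesis using D_L x y by (metis add.commute)
    next
      case False
      then obtain l l' where l: "l \<in> L" "l' \<in> L" "x + l \<in> E \<inter> X" "y + l' \<in> E \<inter> X"
        using x y by (auto simp: D_iff)
      have "(x + l) + (y + l') + (l + l') \<in> D" using key l L_add D_L by auto
      then show ?thesis by (simp add: ac_simps)
    qed
  qed
  have F_D: "f \<in> L" if f: "f \<in> F" "f \<in> D" for f
  proof (rule ccontr)
    assume "f \<notin> L"
    then obtain l where l: "l \<in> L" "f + l \<in> E" using f by (auto simp: D_iff)
    have "f + l \<in> F" using l f L by auto
    with l show False using E_not_F by auto
  qed
  have shift: "v + d \<in> E" if v: "v \<in> E" "v \<notin> X" and d: "d \<in> D" for v d
  proof -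
    have Lv: "w + l \<in> E" if "w \<in> E" "w \<notin> X" "l \<in> L" for w l
      using that outside[of w] stab_E[of w l] L E_V by auto
    show ?thesis
    proof (cases "d \<in> L")
      case False
      then obtain l where l: "l \<in> L" and x: "d + l \<in> E" "d + l \<in> X"
        using d by (auto simp: D_iff)
      define x where "x = d + l"
      have x: "x \<in> E" "x \<in> X" using x by (auto simp: x_def)
      have vx: "v + x \<notin> X" using v x X subspace_add_iff by blast
      then obtain e where e: "e \<in> E" "e + (v + x) \<in> F"
        using maximal[of "v + x"] X v x E_V by auto
      have eX: "e \<notin> X"
        using e(2) vx X subspace_add_iff by blast
      have st: "stab e = stab v"
        using stab_eq[OF _ v(2) x(2)] stab_cong[OF e(2)] v E_V by auto
      have "v + x + e \<in> stab v \<union> stab x \<union> stab e"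
        using sum_in_Un_stab[of v x e] v x e by (simp add: ac_simps)
      moreover have "stab x \<subseteq> stab v" using inside[OF x(2)] outside[of v] v x E_V E_not_F by blast
      ultimately have "v + x + e \<in> stab e" using st by auto
      then have "e + (v + x + e) \<in> E" using stab_E e(1) stab_subset by blast
      then have "v + x \<in> E" by (simp add: ac_simps)
      then have "v + x + l \<in> E" using Lv vx l by auto
      then show ?thesis by (simp add: x_def ac_simps)
    qed (use Lv v in auto)
  qed
  have coset: "x + d \<in> E \<longleftrightarrow> x \<in> E" if x: "x \<in> V" "x \<notin> D" and d: "d \<in> D" for x d
  proof -
    have xd: "x + d \<notin> D" using x d subD subspace_add_iff by blast
    \<comment> \<open>\<open>E \<inter> X\<close> is contained in \<open>D\<close>, so points of
      \<open>E\<close> outside \<open>D\<close> are outside \<open>X\<close> and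
      \<open>shift\<close> applies to them in both directions.\<close>
    have EX: "w \<notin> X" if "w \<in> E" "w \<notin> D" for w
      using that subspace_0[OF L(1)] by (metis D_iff IntI add_0_right)
    show ?thesis
      using shift[of x d] shift[of "x + d" d] EX[of x] EX[of "x + d"] xd x d by (auto simp: ac_simps)
  qed
  \<comment> \<open>\<open>D\<close> meets \<open>F\<close> exactly in \<open>L\<close>, so
    \<open>D = V\<close> would give both \<open>L = F\<close> and \<open>X = V\<close>.\<close>
  have "D \<noteq> V" using proper F_D L D_X X F_subset by blast
  moreover have "D \<noteq> {0}"
  proof
    assume D0: "D = {0}"
    then have L0: "L = {0}" using subspace_0[OF L(1)] by (auto simp: D_def)
    then obtain x where x: "x \<in> X" "x \<notin> F" using nontriv X by auto
    then obtain e where e: "e \<in> E" "e + x \<in> F" using maximal X by blast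
    then have "e \<in> X" using X subspace_add_iff x by blast
    then have "e \<in> D" using e L0 D_iff[of e] by auto
    then show False using D0 e E_not_F[of 0] by auto
  qed
  ultimately show "is_decomposer D"
    unfolding is_decomposer_def using subD D_X X coset by blast
qed

section \<open>Pairwise comparable directions\<close>

text \<open>There is a largest direction \<open>S\<close>. If it is proper in \<open>F\<close>, it
  serves as \<open>L\<close> with \<open>X = V\<close>. Otherwise the set \<open>Z\<close> of cosets
  with full direction decides: either its complement is a subspace, or a hyperplane \<open>H\<close>
  of \<open>F\<close> occurs as a direction and the stabiliser of \<open>Z\<close> serves as
  \<open>X\<close>.\<close>

lemma decomposer_if_chain:
  assumes chain: "\<And>v w. v \<in> V \<Longrightarrow> w \<in> V \<Longrightarrow> v \<notin> F \<Longrightarrow> w \<notin> F \<Longrightarrow> stab v \<subseteq> stab w \<or> stab w \<subseteq> stab v"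
  shows "\<exists>D. is_decomposer D"
proof -
  have "finite (stab ` (V - F))" "stab ` (V - F) \<noteq> {}"
    using finite_V F_subset F_neq_V by auto
  then obtain S where S: "S \<in> stab ` (V - F)" and "\<forall>T\<in>stab ` (V - F). S \<subseteq> T \<longrightarrow> S = T"
    using finite_has_maximal by metis
  then obtain v0 where v0: "v0 \<in> V" "v0 \<notin> F" "S = stab v0" by auto
  have max: "stab v \<subseteq> S" if "v \<in> V" "v \<notin> F" for v
    using chain[OF that(1) v0(1) that(2) v0(2)] \<open>\<forall>T\<in>stab ` (V - F). S \<subseteq> T \<longrightarrow> S = T\<close> that v0 by blast
  show ?thesis
  proof (cases "S = F")
    case False
    show ?thesis
      by (rule decomposerI[of V S]) (use False subspace_V F_subset subspace_stab v0 stab_subset max F_neq_V in auto)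
  next
    case True
    define Z where "Z = {v \<in> V. v \<notin> F \<and> stab v = F}"
    have v0Z: "v0 \<in> Z" using v0 True by (auto simp: Z_def)
    have Z_F: "v + f \<in> Z \<longleftrightarrow> v \<in> Z" if "v \<in> V" "f \<in> F" for v f
      using that F_V by (auto simp: Z_def stab_add_F F_add_iff)
    show ?thesis
    proof (cases "\<forall>x\<in>V - Z. \<forall>y\<in>V - Z. x + y \<notin> Z")
      case True
      have X: "subspace (V - Z)"
        using True F_V by (auto simp: subspace_iff Z_def)
      show ?thesis
      proof (rule decomposerI[of "V - Z" F])
        fix v x assume v: "v \<in> V" "v \<notin> V - Z" and x: "x \<in> V - Z"
        then have "v + x \<notin> V - Z" using X subspace_add_iff by blast
        then show "stab (v + x) = stab v" using v x by (auto simp: Z_def)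
      qed (use X F_subset subspace_F stab_subset v0 v0Z F_big in \<open>auto simp: Z_def\<close>)
    next
      case False
      then obtain x y where xy: "x \<in> V" "x \<notin> Z" "y \<in> V" "y \<notin> Z" "x + y \<in> Z" by auto
      have xF: "x \<notin> F" "y \<notin> F"
        using xy Z_F[of y x] Z_F[of x y] by (auto simp: ac_simps)
      \<comment> \<open>Two directions other than \<open>F\<close> whose cosets sum to one with
        direction \<open>F\<close> must, by \<open>tri_psubset\<close>, both be the same index-two
        subspace of \<open>F\<close>.\<close>
      define H where "H = stab x"
      have xyF: "stab (x + y) = F" "x + y \<notin> F" using xy by (auto simp: Z_def)
      have "H \<subset> F" using xy xF stab_subset by (auto simp: Z_def H_def)
      moreover have "tri H F (stab y)"
        using tri_stab[of x "x + y"] xy xF xyF by (simp add: H_def)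
      moreover have "stab y \<noteq> F" using xy xF by (auto simp: Z_def)
      ultimately have H2: "index_two H F" using tri_psubset by blast
      have sH: "subspace H" using subspace_stab xy xF by (simp add: H_def)
      have dich: "stab w \<subseteq> H \<or> stab w = F" if w: "w \<in> V" "w \<notin> F" for w
      proof (rule ccontr)
        assume n: "\<not> ?thesis"
        then have "H \<subset> stab w" "stab w \<subset> F" using chain[OF w(1) xy(1) w(2) xF(1)] stab_subset by (auto simp: H_def)
        then show False using not_index_two_if_between H2 subspace_stab w by blast
      qed
      \<comment> \<open>The translations preserving \<open>Z\<close>. Directions properly inside
        \<open>H\<close> occur only in \<open>X\<close>, because adding such a coset to one in
        \<open>Z\<close> stays in \<open>Z\<close>; outside \<open>X\<close> only \<open>H\<close>
        and \<open>F\<close> remain.\<close>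
      define X where "X = {u \<in> V. \<forall>v\<in>V. v + u \<in> Z \<longleftrightarrow> v \<in> Z}"
      have X_V: "X \<subseteq> V" by (auto simp: X_def)
      have FX: "F \<subseteq> X" using Z_F F_V by (auto simp: X_def)
      have sX: "subspace X"
        unfolding subspace_iff
      proof (intro conjI ballI)
        show "0 \<in> X" using FX by auto
        fix u u' assume u: "u \<in> X" and u': "u' \<in> X"
        have "v + (u + u') \<in> Z \<longleftrightarrow> v \<in> Z" if "v \<in> V" for v
        proof -
          have "v + u \<in> Z \<longleftrightarrow> v \<in> Z" using u that by (simp add: X_def)
          moreover have "v + u + u' \<in> Z \<longleftrightarrow> v + u \<in> Z"
            using u' V_add[of v u] that X_V u by (auto simp: X_def)
          ultimately show ?thesis by (simp add: add.assoc)
        qed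
        moreover have "u + u' \<in> V" using u u' X_V V_add by blast
        ultimately show "u + u' \<in> X" by (auto simp: X_def)
      qed
      have XZ: "x \<notin> Z" if "x \<in> X" for x
      proof -
        have "0 + x \<in> Z \<longleftrightarrow> 0 \<in> Z" using that F_V[OF zero_F] unfolding X_def by blast
        moreover have "0 \<notin> Z" by (simp add: Z_def)
        ultimately show ?thesis by simp
      qed
      have Z_add: "n + v \<in> Z" if n: "n \<in> V" "n \<notin> F" "stab n \<subset> H" and v: "v \<in> Z" for n v
      proof -
        have v': "v \<in> V" "v \<notin> F" "stab v = F" using v by (auto simp: Z_def)
        have "n + v \<notin> F" using stab_cong[of n v] v' n \<open>H \<subset> F\<close> by auto
        moreover have "stab (n + v) = F"
          using tri_psubset[OF tri_stab[of n v]] calculation v' n \<open>H \<subset> F\<close>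
            not_index_two_if_between[of "stab n" H F] sH by auto
        ultimately show ?thesis using n v' by (auto simp: Z_def)
      qed
      have N_X: "n \<in> X" if n: "n \<in> V" "n \<notin> F" "stab n \<subset> H" for n
      proof -
        have "v + n \<in> Z \<longleftrightarrow> v \<in> Z" for v
          using Z_add[OF n, of v] Z_add[OF n, of "v + n"] by (auto simp: ac_simps)
        then show ?thesis using n by (auto simp: X_def)
      qed
      have out: "stab v = H \<or> stab v = F" if "v \<in> V" "v \<notin> X" for v
        using that dich[of v] N_X[of v] FX by auto
      show ?thesis
      proof (rule decomposerI[of X H])
        show "stab x \<subseteq> H" if "x \<in> X" "x \<notin> F" for x
          using dich[of x] XZ[OF that(1)] that X_V by (auto simp: Z_def)
        show "H \<subseteq> stab v" if "v \<in> V" "v \<notin> X" for v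
          using out[OF that] \<open>H \<subset> F\<close> by auto
        show "stab (v + x) = stab v" if v: "v \<in> V" "v \<notin> X" and x: "x \<in> X" for v x
        proof -
          have vx: "v + x \<in> V" "v + x \<notin> X" using v x sX X_V subspace_add_iff by auto
          have "v + x \<in> Z \<longleftrightarrow> v \<in> Z" using x v by (auto simp: X_def)
          then show ?thesis using out[OF v] out[OF vx] v vx FX by (auto simp: Z_def)
        qed
        show "H \<noteq> {0} \<or> X \<noteq> F"
        proof -
          \<comment> \<open>A zero subspace cannot have index two in a space with two distinct
            nonzero vectors.\<close>
          obtain a b where "a \<in> F" "b \<in> F" "a \<noteq> 0" "b \<noteq> 0" "a \<noteq> b" using F_big by auto
          then have "H \<noteq> {0}" using index_twoD[OF H2, of a b] by auto
          then show ?thesis ..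
        qed
      qed (use sX FX X_V sH \<open>H \<subset> F\<close> in auto)
    qed
  qed
qed

end

section \<open>Incomparable directions\<close>

text \<open>\<open>m\<close> is the largest size of a direction that is incomparable to some other
  direction.\<close>

locale incomparable_stabs = maximal_disjoint_flat scale V E F
  for scale :: "bit \<Rightarrow> 'v::ab_group_add \<Rightarrow> 'v" and V E F +
  fixes m :: nat
  assumes ex_incomparable: "\<exists>v\<in>V - F. \<exists>w\<in>V - F. \<not> stab v \<subseteq> stab w \<and> \<not> stab w \<subseteq> stab v \<and> card (stab v) = m"
    and card_incomparable: "\<And>v w. v \<in> V \<Longrightarrow> w \<in> V \<Longrightarrow> v \<notin> F \<Longrightarrow> w \<notin> F \<Longrightarrow>
      \<not> stab v \<subseteq> stab w \<Longrightarrow> \<not> stab w \<subseteq> stab v \<Longrightarrow> card (stab v) \<le> m"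
begin

text \<open>All three directions contain \<open>stab v \<inter> stab w\<close> with index two, hence
  have equal size.\<close>

lemma incomparable_sum:
  assumes "v \<in> V" "w \<in> V" "v \<notin> F" "w \<notin> F" "\<not> stab v \<subseteq> stab w" "\<not> stab w \<subseteq> stab v"
  shows "v + w \<notin> F" "tri (stab v) (stab w) (stab (v + w))"
    "card (stab w) = card (stab v)" "card (stab (v + w)) = card (stab v)"
proof -
  show n: "v + w \<notin> F" using stab_cong[of v w] assms by auto
  show T: "tri (stab v) (stab w) (stab (v + w))" using tri_stab assms n by blast
  have s: "subspace (stab v)" "subspace (stab w)" "subspace (stab (v + w))"
    using subspace_stab assms n by auto
  have sI: "subspace (stab v \<inter> stab w)" using s by (simp add: subspace_inter)
  note I = tri_incomparable(3,4,5)[OF T assms(5,6)]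
  show "card (stab w) = card (stab v)" "card (stab (v + w)) = card (stab v)"
    using card_index_two[OF I(1) sI s(1)] card_index_two[OF I(2) sI s(2)] card_index_two[OF I(3) sI s(3)]
      finite_stab by simp_all
qed

lemma psubset_sum:
  assumes "v \<in> V" "w \<in> V" "v \<notin> F" "w \<notin> F" "stab v \<subset> stab w"
  shows "v + w \<notin> F"
    "stab (v + w) = stab w \<or> stab (v + w) = stab v \<and> index_two (stab v) (stab w)"
proof -
  show n: "v + w \<notin> F" using stab_cong[of v w] assms by auto
  show "stab (v + w) = stab w \<or> stab (v + w) = stab v \<and> index_two (stab v) (stab w)"
    using tri_psubset[OF tri_stab[of v w] assms(5)] assms n by auto
qed

section \<open>Cosets sorted by the size of their direction\<close>

definition N :: "'v set" where
  "N = {v \<in> V. v \<notin> F \<and> card (stab v) = m}"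

definition low :: "'v \<Rightarrow> bool" where
  "low v \<longleftrightarrow> v \<in> V \<and> v \<notin> F \<and> card (stab v) < m"

definition high :: "'v \<Rightarrow> bool" where
  "high v \<longleftrightarrow> v \<in> V \<and> v \<notin> F \<and> card (stab v) > m"

lemma N_D: "n \<in> N \<Longrightarrow> n \<in> V" "n \<in> N \<Longrightarrow> n \<notin> F" "n \<in> N \<Longrightarrow> card (stab n) = m"
  by (auto simp: N_def)

lemma cases_V:
  assumes "v \<in> V"
  obtains "v \<in> F" | "low v" | "v \<in> N" | "high v"
proof -
  consider "card (stab v) < m" | "card (stab v) = m" | "card (stab v) > m" by linarith
  then show thesis using assms that unfolding N_def low_def high_def by cases blast+
qed

lemma subspace_stab_N: "n \<in> N \<Longrightarrow> subspace (stab n)"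
  using subspace_stab N_D by blast

lemma N_incomparable:
  assumes "n \<in> N" "n' \<in> N" "stab n \<noteq> stab n'"
  shows "\<not> stab n \<subseteq> stab n'" "\<not> stab n' \<subseteq> stab n"
proof -
  have "card (stab n) = card (stab n')" using assms N_D by simp
  then show "\<not> stab n \<subseteq> stab n'" "\<not> stab n' \<subseteq> stab n"
    using card_subset_eq[OF finite_stab] assms(3) by metis+
qed

lemma N_tri:
  assumes "n \<in> N" "n' \<in> N" "stab n \<noteq> stab n'"
  shows "tri (stab n) (stab n') (stab (n + n'))"
  using incomparable_sum(2)[OF N_D(1)[OF assms(1)] N_D(1)[OF assms(2)] N_D(2)[OF assms(1)] N_D(2)[OF assms(2)]
    N_incomparable[OF assms]] .

lemma N_sum:
  assumes "n \<in> N" "n' \<in> N" "stab n \<noteq> stab n'"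
  shows "n + n' \<in> N" "stab (n + n') \<noteq> stab n"
proof -
  note i = N_incomparable[OF assms]
  have n: "n \<in> V" "n' \<in> V" "n \<notin> F" "n' \<notin> F" using assms N_D by auto
  show "n + n' \<in> N"
    using incomparable_sum(1,4)[OF n i] V_add[OF n(1,2)] N_D(3)[OF assms(1)] by (simp add: N_def)
  show "stab (n + n') \<noteq> stab n"
    using tri_incomparable(1)[OF N_tri[OF assms] i] i by auto
qed

lemma N_other:
  assumes "n \<in> N"
  obtains n' where "n' \<in> N" "stab n' \<noteq> stab n"
proof -
  obtain v w where vw: "v \<in> V - F" "w \<in> V - F" "\<not> stab v \<subseteq> stab w" "\<not> stab w \<subseteq> stab v" "card (stab v) = m"
    using ex_incomparable by auto
  then have "v \<in> N" "w \<in> N" using incomparable_sum(3)[of v w] by (auto simp: N_def)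
  then show thesis using that vw by (cases "stab v = stab n") auto
qed

lemma N_nonempty: "N \<noteq> {}"
  using ex_incomparable by (auto simp: N_def)

text \<open>Incomparable directions have equal size, so a direction of size below \<open>m\<close>
  is comparable to each one in \<open>N\<close>.\<close>

lemma low_psubset:
  assumes "low v" "n \<in> N"
  shows "stab v \<subset> stab n"
proof -
  have "stab v \<subseteq> stab n \<or> stab n \<subseteq> stab v"
    using incomparable_sum(3)[of v n] assms by (auto simp: low_def N_def)
  moreover have "\<not> stab n \<subseteq> stab v"
    using assms card_mono[OF finite_stab, of "stab n" v] by (auto simp: low_def N_def)
  ultimately show ?thesis by auto
qed

text \<open>Maximality of \<open>m\<close> makes a larger direction comparable to each one in
  \<open>N\<close>.\<close>

lemma high_psubset:
  assumes "high v" "n \<in> N"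
  shows "stab n \<subset> stab v"
proof -
  have "stab v \<subseteq> stab n \<or> stab n \<subseteq> stab v"
    using card_incomparable[of v n] assms by (auto simp: high_def N_def)
  moreover have "\<not> stab v \<subseteq> stab n"
    using assms card_mono[OF finite_stab, of "stab v" n] by (auto simp: high_def N_def)
  ultimately show ?thesis by auto
qed

text \<open>A direction from \<open>N\<close> lies strictly between, which rules out the index-two
  alternative of \<open>psubset_sum\<close>.\<close>

lemma low_high_sum:
  assumes "low l" "high h"
  shows "high (l + h)" "stab (l + h) = stab h"
proof -
  obtain n where n: "n \<in> N" using N_nonempty by auto
  note ps = low_psubset[OF assms(1) n] high_psubset[OF assms(2) n]
  have "\<not> index_two (stab l) (stab h)"
    using not_index_two_if_between[OF ps] subspace_stab_N n by auto
  then show "stab (l + h) = stab h" "high (l + h)"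
    using psubset_sum[of l h] ps assms by (auto simp: low_def high_def)
qed

lemma N_high_sum:
  assumes "n \<in> N" "high h"
  shows "stab (n + h) = stab h \<and> high (n + h) \<or> stab (n + h) = stab n \<and> n + h \<in> N \<and> index_two (stab n) (stab h)"
proof -
  have V: "n \<in> V" "h \<in> V" "n \<notin> F" "h \<notin> F" "card (stab n) = m" "card (stab h) > m"
    using assms by (simp_all add: N_def high_def)
  note * = psubset_sum[OF V(1-4) high_psubset[OF assms(2,1)]]
  show ?thesis
    using *(2) *(1) V_add[OF V(1,2)] V(5,6) unfolding N_def high_def mem_Collect_eq by argo
qed

lemma low_N_sum:
  assumes "low l" "n \<in> N"
  shows "stab (l + n) = stab n \<and> l + n \<in> N \<or> stab (l + n) = stab l \<and> low (l + n) \<and> index_two (stab l) (stab n)"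
proof -
  have V: "l \<in> V" "n \<in> V" "l \<notin> F" "n \<notin> F" "card (stab l) < m" "card (stab n) = m"
    using assms by (simp_all add: N_def low_def)
  note * = psubset_sum[OF V(1-4) low_psubset[OF assms]]
  show ?thesis
    using *(2) *(1) V_add[OF V(1,2)] V(5,6) unfolding N_def low_def mem_Collect_eq by argo
qed

section \<open>The stabiliser of the directions of size m\<close>

text \<open>The stabiliser from \<open>colour_stabiliser\<close>, with \<open>N\<close> coloured by
  \<open>stab\<close>.\<close>

definition Q :: "'v set" where
  "Q = {q \<in> V. \<forall>n\<in>N. q + n \<in> N \<and> stab (q + n) = stab n}"

definition J :: "'v set" where
  "J = (\<Inter>n\<in>N. stab n)"

lemma Q_V: "q \<in> Q \<Longrightarrow> q \<in> V"
  by (auto simp: Q_def)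

lemma Q_N: "q \<in> Q \<Longrightarrow> n \<in> N \<Longrightarrow> q + n \<in> N" "q \<in> Q \<Longrightarrow> n \<in> N \<Longrightarrow> stab (q + n) = stab n"
  by (auto simp: Q_def)

lemma F_Q: "F \<subseteq> Q"
proof
  fix f assume f: "f \<in> F"
  have "f + n \<in> N \<and> stab (f + n) = stab n" if "n \<in> N" for n
  proof -
    have "stab (f + n) = stab n" using stab_add_F[OF f, of n] by (simp add: add.commute)
    then show ?thesis using that F_V[OF f] F_add_iff(2)[OF f, of n] by (auto simp: N_def)
  qed
  then show "f \<in> Q" using f F_V by (auto simp: Q_def)
qed

text \<open>The third direction consists of the intersection of the first two and the sums across
  their differences, so it depends on the two directions alone.\<close>

lemma N_det:
  assumes "x \<in> N" "y \<in> N" "x' \<in> N" "y' \<in> N" "stab x = stab x'" "stab y = stab y'" "stab x \<noteq> stab y"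
  shows "stab (x + y) = stab (x' + y')"
proof -
  have ne: "stab x' \<noteq> stab y'" using assms by simp
  show ?thesis
    using tri_incomparable(7)[OF N_tri[OF assms(1,2,7)] N_incomparable[OF assms(1,2,7)]]
      tri_incomparable(7)[OF N_tri[OF assms(3,4) ne] N_incomparable[OF assms(3,4) ne]]
      assms(5,6) by simp
qed

lemma Q_facts:
  shows subspace_Q: "subspace Q" and Q_Int_N: "Q \<inter> N = {}" and subspace_Q_N: "subspace (Q \<union> N)"
    and N_same: "\<And>x y. x \<in> N \<Longrightarrow> y \<in> N \<Longrightarrow> stab x = stab y \<Longrightarrow> x + y \<in> Q"
proof -
  have sub: "N \<subseteq> V" by (auto simp: N_def)
  have sum: "x + y \<in> N \<and> stab (x + y) \<noteq> stab x" if "x \<in> N" "y \<in> N" "stab x \<noteq> stab y" for x y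
    using N_sum that by blast
  have two: "\<exists>y\<in>N. stab y \<noteq> stab x" if "x \<in> N" for x
    using N_other[OF that] by blast
  note * = colour_stabiliser[of V N stab, OF subspace_V sub sum N_det two, folded Q_def]
  show "subspace Q" "Q \<inter> N = {}" "subspace (Q \<union> N)" by (rule *; assumption)+
  show "\<And>x y. x \<in> N \<Longrightarrow> y \<in> N \<Longrightarrow> stab x = stab y \<Longrightarrow> x + y \<in> Q" by (rule *(4))
qed

lemma J_subset: "n \<in> N \<Longrightarrow> J \<subseteq> stab n"
  by (auto simp: J_def)

lemma low_subset_J: "low v \<Longrightarrow> stab v \<subseteq> J"
  unfolding J_def using low_psubset by blast

lemma stab_N_neq_F: "n \<in> N \<Longrightarrow> stab n \<noteq> F"
proof
  assume n: "n \<in> N" "stab n = F"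
  obtain n' where "n' \<in> N" "stab n' \<noteq> stab n" using N_other[OF n(1)] .
  then show False using N_incomparable(1)[of n' n] n stab_subset by auto
qed

lemma J_psubset_F: "J \<subset> F"
proof -
  obtain n where "n \<in> N" using N_nonempty by auto
  then show ?thesis using J_subset[of n] stab_N_neq_F[of n] stab_subset[of n] by auto
qed

lemma subspace_J: "subspace J"
  unfolding J_def by (rule subspace_Inter) (use subspace_stab_N in blast)

text \<open>Two distinct directions and the direction of their sum already have a subspace as
  union.\<close>

lemma subspace_Union_N: "subspace (\<Union>n\<in>N. stab n)"
  unfolding subspace_iff
proof (intro conjI ballI)
  show "0 \<in> (\<Union>n\<in>N. stab n)" using N_nonempty subspace_0[OF subspace_stab_N] by blast
  fix f g assume "f \<in> (\<Union>n\<in>N. stab n)" "g \<in> (\<Union>n\<in>N. stab n)"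
  then obtain n n' where n: "n \<in> N" "f \<in> stab n" "n' \<in> N" "g \<in> stab n'" by auto
  show "f + g \<in> (\<Union>n\<in>N. stab n)"
  proof (cases "stab n = stab n'")
    case True
    then show ?thesis using n subspace_add[OF subspace_stab_N] by blast
  next
    case False
    have "subspace (stab n \<union> stab n' \<union> stab (n + n'))"
      using tri_incomparable(8)[OF N_tri N_incomparable] n False by blast
    then have "f + g \<in> stab n \<union> stab n' \<union> stab (n + n')"
      using n subspace_add by blast
    then show ?thesis using n N_sum[of n n'] False by blast
  qed
qed

section \<open>Decomposers away from the rigid configurations\<close>

text \<open>The cosets that are not high form a subspace: two of them with a high sum would have to
  lie in \<open>N\<close> with equal directions, and then the sum would lie in \<open>Q\<close>.
  This subspace and the union of the directions in \<open>N\<close> satisfy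
  \<open>decomposerI\<close> unless both are everything.\<close>

lemma decomposer_or_Union_eq_F:
  assumes "\<And>q. q \<in> Q \<Longrightarrow> \<not> high q"
  shows "(\<exists>D. is_decomposer D) \<or> (\<forall>v. \<not> high v) \<and> F = (\<Union>n\<in>N. stab n)"
proof (rule disjCI)
  assume n: "\<not> ((\<forall>v. \<not> high v) \<and> F = (\<Union>n\<in>N. stab n))"
  define X where "X = {v \<in> V. \<not> high v}"
  have sum: "\<not> high (x + y)" if x: "x \<in> X" and y: "y \<in> X" for x y
  proof
    assume h: "high (x + y)"
    have xy: "x \<in> V" "y \<in> V" "\<not> high x" "\<not> high y" using x y by (auto simp: X_def)
    have hF: "high (v + f) \<longleftrightarrow> high v" if "v \<in> V" "f \<in> F" for v f
      using that F_V by (auto simp: high_def stab_add_F F_add_iff)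
    have "x \<notin> F" using hF[of y x] xy h by (auto simp: ac_simps)
    moreover have "\<not> low x" using low_high_sum[of x "x + y"] h xy by auto
    ultimately have xN: "x \<in> N" using xy(1,3) by (metis cases_V)
    then have "stab y = stab x" "y \<in> N" using N_high_sum[OF xN h] xy by auto
    then show False using N_same[of x y] xN assms h by auto
  qed
  have X: "subspace X" unfolding subspace_iff using sum F_V by (auto simp: X_def high_def)
  have FX: "F \<subseteq> X" using F_V by (auto simp: X_def high_def)
  have N_X: "N \<subseteq> X" by (auto simp: X_def high_def N_def)
  show "\<exists>D. is_decomposer D"
  proof (rule decomposerI[of X "\<Union>n\<in>N. stab n"])
    show "stab x \<subseteq> (\<Union>n\<in>N. stab n)" if "x \<in> X" "x \<notin> F" for x
    proof -
      have "x \<in> V" "\<not> high x" using that by (auto simp: X_def)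
      then show ?thesis
      proof (cases rule: cases_V)
        case 2 then show ?thesis using low_psubset N_nonempty by blast
      qed (use that in auto)
    qed
    show "(\<Union>n\<in>N. stab n) \<subseteq> stab v" if "v \<in> V" "v \<notin> X" for v
      using that high_psubset[of v] by (auto simp: X_def)
    show "stab (v + x) = stab v" if v: "v \<in> V" "v \<notin> X" and x: "x \<in> X" for v x
    proof -
      have h: "high v" using v by (auto simp: X_def)
      have vx: "v + x \<in> V" using v x by (auto simp: X_def)
      moreover have "v + x \<notin> X" using v x X subspace_add_iff by blast
      ultimately have h': "high (v + x)" by (auto simp: X_def)
      have "x \<in> V" "\<not> high x" using x by (auto simp: X_def)
      then show ?thesis
      proof (cases rule: cases_V)
        case 1 then show ?thesis by (rule stab_add_F)
      next
        case 2 then show ?thesis using low_high_sum[OF 2 h] by (simp add: ac_simps)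
      next
        case 3 then show ?thesis using N_high_sum[OF 3 h] h' unfolding add.commute[of x v]
          by (auto simp: N_def high_def)
      qed auto
    qed
    show "(\<Union>n\<in>N. stab n) \<noteq> F \<or> X \<noteq> V" using n by (auto simp: X_def high_def)
    show "(\<Union>n\<in>N. stab n) \<noteq> {0} \<or> X \<noteq> F" using N_X N_nonempty N_D by blast
  qed (use X FX subspace_Union_N stab_subset in \<open>auto simp: X_def\<close>)
qed

text \<open>As \<open>Q \<union> N\<close> is a subspace, \<open>l + n\<close> is not in
  \<open>N\<close>, which leaves the index-two alternative of \<open>low_N_sum\<close>. An element
  of \<open>J\<close> outside \<open>stab l\<close> would then pull all of \<open>stab n\<close>
  into any other direction \<open>stab n'\<close>.\<close>

lemma low_outside:
  assumes l: "low l" "l \<notin> Q \<union> N"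
  shows "stab l = J" "n \<in> N \<Longrightarrow> index_two (stab l) (stab n)" "n \<in> N \<Longrightarrow> stab (l + n) = stab l"
    "n \<in> N \<Longrightarrow> low (l + n)"
proof -
  have nN: "l + n \<notin> N" if "n \<in> N" for n
    using subspace_add_iff(1)[OF subspace_Q_N, of n l] l(2) that by auto
  have *: "stab (l + n) = stab l \<and> low (l + n) \<and> index_two (stab l) (stab n)" if "n \<in> N" for n
    using low_N_sum[OF l(1) that] nN[OF that] by auto
  then show ix: "index_two (stab l) (stab n)" and "stab (l + n) = stab l" "low (l + n)" if "n \<in> N" for n
    using that by auto
  have "J \<subseteq> stab l"
  proof
    fix j assume j: "j \<in> J"
    obtain n where n: "n \<in> N" using N_nonempty by auto
    obtain n' where n': "n' \<in> N" "stab n' \<noteq> stab n" using N_other[OF n] by auto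
    obtain f where f: "f \<in> stab n" "f \<notin> stab n'" using N_incomparable n n' by blast
    have jn: "j \<in> stab n" "j \<in> stab n'" using j J_subset n n' by auto
    have ll: "stab l \<subseteq> stab n'" using low_psubset[OF l(1) n'(1)] by auto
    show "j \<in> stab l"
    proof (rule ccontr)
      assume "j \<notin> stab l"
      then have "f + j \<in> stab l" using index_twoD[OF ix[OF n], of f j] f ll jn by auto
      then show False using ll f jn subspace_add_iff(1)[OF subspace_stab_N[OF n'(1)] jn(2)] by auto
    qed
  qed
  then show "stab l = J" using low_subset_J[OF l(1)] by auto
qed

text \<open>Directions in \<open>Q\<close> outside \<open>F\<close> are contained in
  \<open>J\<close>, and those outside \<open>Q \<union> N\<close> equal \<open>J\<close>, so
  \<open>decomposerI\<close> applies to \<open>Q\<close> and \<open>J\<close>.\<close>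

lemma decomposer_or_Q_eq_F:
  assumes "\<And>v. \<not> high v"
  shows "(\<exists>D. is_decomposer D) \<or> Q = F \<and> J = {0}"
proof (rule disjCI)
  assume n: "\<not> (Q = F \<and> J = {0})"
  have out: "stab v = J" if "v \<in> V" "v \<notin> Q \<union> N" for v
    using that assms F_Q low_outside(1)[of v] by (cases rule: cases_V[of v]) auto
  show "\<exists>D. is_decomposer D"
  proof (rule decomposerI[of Q J])
    show "stab x \<subseteq> J" if "x \<in> Q" "x \<notin> F" for x
      using Q_V[OF that(1)] that assms Q_Int_N low_subset_J by (cases rule: cases_V) auto
    show "J \<subseteq> stab v" if "v \<in> V" "v \<notin> Q" for v
      using that out[of v] J_subset by auto
    show "stab (v + x) = stab v" if v: "v \<in> V" "v \<notin> Q" and x: "x \<in> Q" for v x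
    proof (cases "v \<in> N")
      case True
      then show ?thesis using Q_N[OF x, of v] by (simp add: ac_simps)
    next
      case False
      then have "v + x \<notin> Q \<union> N"
        using subspace_add_iff(1)[OF subspace_Q_N, of x v] x v by auto
      then show ?thesis using out[of v] out[of "v + x"] v x False Q_V by auto
    qed
  qed (use n subspace_Q subspace_J F_Q Q_V J_psubset_F in auto)
qed

text \<open>The direction \<open>S\<close> of a high coset in \<open>Q\<close> is the largest one
  within \<open>Q \<union> N\<close> and is contained in all high ones. Each way in which the stated
  configuration fails fits \<open>decomposerI\<close>: with \<open>Q \<union> N\<close> and
  \<open>S\<close>, with \<open>V\<close> and \<open>S\<close>, or with the low part of
  \<open>Q\<close> and \<open>J\<close>.\<close>

lemma decomposer_or_hyperplanes:
  assumes q: "q \<in> Q" "high q"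
  shows "(\<exists>D. is_decomposer D) \<or>
    V = Q \<union> N \<and> (\<forall>n\<in>N. index_two (stab n) F) \<and> (\<forall>q\<in>Q - F. stab q = F)"
proof -
  define S where "S = stab q"
  have qV: "q \<in> V" "q \<notin> F" using q by (auto simp: high_def)
  have S_F: "S \<subseteq> F" "subspace S" using stab_subset subspace_stab qV by (auto simp: S_def)
  have N_high: "\<not> high n" if "n \<in> N" for n using that by (auto simp: high_def N_def)
  have ix: "index_two (stab n) (stab q')" if "n \<in> N" "q' \<in> Q" "high q'" for n q'
  proof -
    have "n + q' \<in> N" using Q_N(1)[OF that(2,1)] by (simp add: add.commute)
    then show ?thesis using N_high_sum[OF that(1,3)] N_high by auto
  qed
  \<comment> \<open>\<open>stab q'\<close> consists of \<open>stab n\<close> and its translate by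
    some \<open>g\<close> in \<open>stab n'\<close>; every high direction contains both
    \<open>stab n\<close> and \<open>stab n'\<close>.\<close>
  have sub: "stab q' \<subseteq> stab v" if q': "q' \<in> Q" "high q'" and v: "high v" for q' v
  proof
    fix x assume x: "x \<in> stab q'"
    obtain n where n: "n \<in> N" using N_nonempty by auto
    obtain n' where n': "n' \<in> N" "stab n' \<noteq> stab n" using N_other[OF n] .
    obtain g where g: "g \<in> stab n'" "g \<notin> stab n" using N_incomparable(1)[OF n'(1) n n'(2)] by auto
    have gq: "g \<in> stab q'" and gv: "g \<in> stab v" using g high_psubset n' q' v by blast+
    have nv: "stab n \<subset> stab v" using high_psubset[OF v n] .
    show "x \<in> stab v"
    proof (cases "x \<in> stab n")
      case False
      then have "x + g \<in> stab n" using index_twoD[OF ix[OF n q'] x _ gq] g by auto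
      moreover have "subspace (stab v)" using v subspace_stab by (auto simp: high_def)
      ultimately show ?thesis using nv gv subspace_add_iff(1)[of "stab v" g x] by auto
    qed (use nv in auto)
  qed
  have S_max: "stab x \<subseteq> S" if "x \<in> Q \<union> N" "x \<notin> F" for x
  proof -
    obtain n where n: "n \<in> N" using N_nonempty by auto
    have nS: "stab n' \<subset> S" if "n' \<in> N" for n' using high_psubset[OF q(2) that] by (simp add: S_def)
    have "x \<in> V" using that Q_V N_D(1) by auto
    then show ?thesis
    proof (cases rule: cases_V)
      case 2 then show ?thesis using low_psubset[OF 2 n] nS[OF n] by auto
    next
      case 3 then show ?thesis using nS by auto
    next
      case 4 then show ?thesis using sub[of x q] q that N_high by (auto simp: S_def)
    qed (use that in auto)
  qed
  \<comment> \<open>For a low \<open>v\<close> the coset of \<open>q + n\<close> would be the sum of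
    the low \<open>v + n\<close> and the high \<open>v + q\<close>, hence high, although it is in
    \<open>N\<close>.\<close>
  have out: "high v" if v: "v \<in> V" "v \<notin> Q \<union> N" for v
    using v(1)
  proof (cases rule: cases_V)
    case 2
    obtain n where n: "n \<in> N" using N_nonempty by auto
    have "high ((v + n) + (v + q))"
      using low_high_sum(1)[OF low_outside(4)[OF 2 v(2) n] low_high_sum(1)[OF 2 q(2)]] .
    moreover have "(v + n) + (v + q) = q + n" by (simp add: ac_simps)
    ultimately show ?thesis using Q_N(1)[OF q(1) n] N_high by auto
  qed (use v F_Q in auto)
  show ?thesis
  proof (cases "V = Q \<union> N")
    case False
    have "\<exists>D. is_decomposer D"
    proof (rule decomposerI[of "Q \<union> N" S])
      show "S \<subseteq> stab v" if "v \<in> V" "v \<notin> Q \<union> N" for v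
        using sub[OF q out[OF that]] by (simp add: S_def)
      have add_N: "stab (v + n) = stab v \<and> v + n \<in> V \<and> v + n \<notin> Q \<union> N"
        if v: "v \<in> V" "v \<notin> Q \<union> N" and n: "n \<in> N" for v n
      proof -
        have "v + n \<notin> Q \<union> N" using subspace_add_iff(1)[OF subspace_Q_N, of n v] n v by auto
        moreover have "stab (v + n) = stab v"
          using calculation N_high_sum[OF n out[OF v]] unfolding add.commute[of n v] by blast
        ultimately show ?thesis using V_add[OF v(1) N_D(1)[OF n]] by blast
      qed
      show "stab (v + x) = stab v" if v: "v \<in> V" "v \<notin> Q \<union> N" and x: "x \<in> Q \<union> N" for v x
      proof (cases "x \<in> N")
        case False
        obtain n where n: "n \<in> N" using N_nonempty by auto
        have "x + n \<in> N" using Q_N(1) x False n by auto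
        then have "stab (v + n + (x + n)) = stab v" using add_N[OF v n] add_N[of "v + n" "x + n"] by auto
        then show ?thesis by (simp add: ac_simps)
      qed (use add_N[OF v] in blast)
      show "Q \<union> N \<subseteq> V" using Q_V N_D(1) by auto
      show "S \<noteq> {0} \<or> Q \<union> N \<noteq> F" using N_nonempty N_D(2) by auto
    qed (use False S_F subspace_Q_N F_Q S_max in auto)
    then show ?thesis by simp
  next
    case V: True
    show ?thesis
    proof (cases "S = F")
      case False
      have "\<exists>D. is_decomposer D"
        by (rule decomposerI[of V S]) (use False S_F S_max V F_subset F_neq_V subspace_V in auto)
      then show ?thesis ..
    next
      case S: True
      show ?thesis
      proof (cases "\<exists>l\<in>Q. low l")
        case True
        define X where "X = F \<union> {l \<in> Q. low l}"
        have X_Q: "X \<subseteq> Q" using F_Q by (auto simp: X_def)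
        have low_F: "low (l + f)" if "low l" "f \<in> F" for l f
          using that F_V[OF that(2)] by (auto simp: low_def stab_add_F F_add_iff)
        have "x + y \<in> X" if x: "x \<in> X" and y: "y \<in> X" for x y
        proof -
          have xyQ: "x + y \<in> Q" using x y X_Q subspace_add[OF subspace_Q] by blast
          show ?thesis
          proof (cases "x \<in> F \<or> y \<in> F")
            case True
            then show ?thesis using x y xyQ low_F[of x y] low_F[of y x] by (auto simp: X_def add.commute)
          next
            case False
            then have l: "low x" "low y" using x y by (auto simp: X_def)
            have "\<not> high (x + y)"
            proof
              assume "high (x + y)"
              then have "high (x + (x + y))" by (rule low_high_sum(1)[OF l(1)])
              then show False using l by (simp add: low_def high_def)
            qed
            with Q_V[OF xyQ] show ?thesis
              by (cases rule: cases_V) (use xyQ Q_Int_N in \<open>auto simp: X_def\<close>)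
          qed
        qed
        then have sX: "subspace X" by (auto simp: subspace_iff X_def)
        have "\<exists>D. is_decomposer D"
        proof (rule decomposerI[of X J])
          show "stab x \<subseteq> J" if "x \<in> X" "x \<notin> F" for x
            using that low_subset_J by (auto simp: X_def)
          have out: "v \<in> N \<or> high v" if v: "v \<in> V" "v \<notin> X" for v
            using v(1) by (cases rule: cases_V) (use v V in \<open>auto simp: X_def\<close>)
          show "J \<subseteq> stab v" if v: "v \<in> V" "v \<notin> X" for v
          proof -
            obtain n where "n \<in> N" using N_nonempty by auto
            then show ?thesis using out[OF v] J_subset high_psubset[of v n] by blast
          qed
          show "stab (v + x) = stab v" if v: "v \<in> V" "v \<notin> X" and x: "x \<in> X" for v x
          proof (cases "x \<in> F")
            case False
            then have "x \<in> Q" "low x" using x by (auto simp: X_def)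
            then show ?thesis
              using out[OF v] Q_N(2)[of x v] low_high_sum(2)[of x v] by (auto simp: add.commute)
          qed (rule stab_add_F)
          show "X \<subseteq> V" using X_Q Q_V by auto
          show "J \<noteq> {0} \<or> X \<noteq> F" using True by (auto simp: X_def low_def)
        qed (use sX subspace_J J_psubset_F in \<open>auto simp: X_def\<close>)
        then show ?thesis ..
      next
        case False
        have "stab q' = F" if q': "q' \<in> Q" "q' \<notin> F" for q'
        proof -
          have "high q'"
            using Q_V[OF q'(1)] by (cases rule: cases_V) (use q' False Q_Int_N in auto)
          then show ?thesis using sub[OF q, of q'] S stab_subset[of q'] unfolding S_def by blast
        qed
        then show ?thesis using V ix[OF _ q] S by (auto simp: S_def)
      qed
    qed
  qed
qed

end

section \<open>Even planes\<close>

text \<open>The configuration in which every direction is \<open>F\<close> or a hyperplane of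
  \<open>F\<close>: such a direction is the kernel of a functional on \<open>F\<close>, and by
  \<open>stab_add\<close> this functional depends additively on the coset.\<close>

locale linear_stabs = maximal_disjoint_flat scale V E F
  for scale :: "bit \<Rightarrow> 'v::ab_group_add \<Rightarrow> 'v" and V E F +
  assumes add_F_in_E_iff: "\<And>v f. v \<in> V \<Longrightarrow> f \<in> F \<Longrightarrow> v + f \<in> E \<longleftrightarrow> (v \<in> E \<longleftrightarrow> f \<in> stab v)"
    and stab_add: "\<And>x y f. x \<in> V \<Longrightarrow> y \<in> V \<Longrightarrow> f \<in> F \<Longrightarrow> f \<in> stab (x + y) \<longleftrightarrow> (f \<in> stab x \<longleftrightarrow> f \<in> stab y)"
    and full_in_E: "\<And>q. q \<in> V \<Longrightarrow> q \<notin> F \<Longrightarrow> stab q = F \<Longrightarrow> q \<in> E"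
    and two_stabs: "\<exists>x\<in>V. \<exists>y\<in>V. stab x \<noteq> F \<and> stab y \<noteq> F \<and> stab x \<noteq> stab y"
begin

section \<open>The indicator function and its functionals on F\<close>

definition chi :: "'v \<Rightarrow> bit" where
  "chi v = of_bool (v \<in> E)"

text \<open>For \<open>v\<close> in \<open>V\<close>, the linear functional on \<open>F\<close> with
  kernel \<open>stab v\<close>.\<close>

definition lam :: "'v \<Rightarrow> 'v \<Rightarrow> bit" where
  "lam v f = of_bool (f \<notin> stab v)"

text \<open>For independent arguments, the parity of the number of points of \<open>E\<close> in the
  plane they span.\<close>

definition plane_sum :: "'v \<Rightarrow> 'v \<Rightarrow> 'v \<Rightarrow> bit" where
  "plane_sum x y z = chi x + chi y + chi z + chi (x + y) + chi (x + z) + chi (y + z) + chi (x + y + z)"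

lemma bit_add_self [simp]: "a + a = (0::bit)"
  by (cases a) simp_all

lemma bit_add_left [simp]: "a + (a + b) = (b::bit)"
  by (cases a; cases b) simp_all

declare add_bit_eq_xor [simp del] mult_bit_eq_and [simp del]

lemma chi_add_F: "v \<in> V \<Longrightarrow> f \<in> F \<Longrightarrow> chi (v + f) = chi v + lam v f"
  using add_F_in_E_iff[of v f] by (auto simp: chi_def lam_def)

lemma lam_add: "x \<in> V \<Longrightarrow> y \<in> V \<Longrightarrow> f \<in> F \<Longrightarrow> lam (x + y) f = lam x f + lam y f"
  using stab_add[of x y f] by (auto simp: lam_def)

text \<open>Evaluate \<open>chi (v + f + g)\<close> in one step and in two.\<close>

lemma lam_add_right:
  assumes "v \<in> V" "f \<in> F" "g \<in> F"
  shows "lam v (f + g) = lam v f + lam v g"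
proof -
  have "chi (v + f + g) = chi (v + (f + g))" by (simp add: add.assoc)
  moreover have "lam (v + f) g = lam v g" using stab_add_F[of f v] assms by (simp add: lam_def)
  ultimately have "chi v + lam v f + lam v g = chi v + lam v (f + g)"
    using assms chi_add_F[of "v + f" g] chi_add_F[of v f] chi_add_F[of v "f + g"] F_V by simp
  then have "chi v + (chi v + (lam v f + lam v g)) = chi v + (chi v + lam v (f + g))"
    by (simp only: add.assoc)
  then show ?thesis by (simp only: bit_add_left)
qed

lemma lam_full: "stab q = F \<Longrightarrow> f \<in> F \<Longrightarrow> lam q f = 0"
  by (simp add: lam_def)

lemma lam_scale: "v \<in> V \<Longrightarrow> f \<in> F \<Longrightarrow> lam v (scale a f) = a * lam v f"
  using lam_add_right[of v f f] by (cases a) auto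

lemma scale_F: "f \<in> F \<Longrightarrow> scale a f \<in> F"
  by (cases a) auto

text \<open>Every value of \<open>lam\<close> at a generator and a shift enters an even number of
  times, so the sum depends only on the three \<open>F\<close>-cosets.\<close>

lemma plane_sum_add_F:
  assumes "x \<in> V" "y \<in> V" "z \<in> V" "f \<in> F" "g \<in> F" "h \<in> F"
  shows "plane_sum (x + f) (y + g) (z + h) = plane_sum x y z"
proof -
  have *: "x + f + (y + g) = x + y + (f + g)" "x + f + (z + h) = x + z + (f + h)"
    "y + g + (z + h) = y + z + (g + h)" "x + y + (f + g) + (z + h) = x + y + z + (f + g + h)"
    by (simp_all add: ac_simps)
  show ?thesis
    unfolding plane_sum_def * using assms
    by (simp add: chi_add_F lam_add lam_add_right)
qed

lemma full_sum_iff: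
  assumes "x \<in> V" "y \<in> V"
  shows "stab (x + y) = F \<longleftrightarrow> stab x = stab y"
proof
  assume "stab (x + y) = F"
  then have "f \<in> stab x \<longleftrightarrow> f \<in> stab y" if "f \<in> F" for f using stab_add[OF assms that] that by simp
  then show "stab x = stab y" using stab_subset by blast
next
  assume "stab x = stab y"
  then show "stab (x + y) = F" using stab_add[OF assms] stab_subset by blast
qed

lemma obtain_lam:
  assumes "stab x \<noteq> F"
  obtains f where "f \<in> F" "lam x f = 1"
  using assms stab_subset by (auto simp: lam_def)

section \<open>Dual vectors in F\<close>

text \<open>Take \<open>f\<close> where \<open>lam x\<close> is 1 and \<open>g\<close> where
  \<open>lam x\<close> and \<open>lam y\<close> differ; one of \<open>f\<close>, \<open>g\<close>,
  \<open>f + g\<close> works.\<close>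

lemma dual_pair:
  assumes V: "x \<in> V" "y \<in> V" and n: "stab x \<noteq> F" "stab (x + y) \<noteq> F"
  obtains d where "d \<in> F" "lam x d = 1" "lam y d = 0"
proof -
  obtain f where f: "f \<in> F" "lam x f = 1" using obtain_lam n by blast
  obtain g where g: "g \<in> F" "lam (x + y) g = 1" using obtain_lam n by blast
  have g': "lam x g + lam y g = 1" using g lam_add V by simp
  show thesis
  proof (cases "lam y f = 0")
    case True
    then show thesis using that f by auto
  next
    case False
    then have fy: "lam y f = 1" by simp
    show thesis
    proof (cases "lam y g = 0")
      case True
      then show thesis using that g g' by auto
    next
      case False
      then have "lam y g = 1" "lam x g = 0" using g' by (cases "lam x g"; simp)+
      then show thesis using that[of "f + g"] f g fy lam_add_right V by simp
    qed
  qed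
qed

text \<open>The hypotheses say that \<open>lam x\<close> is outside the span of \<open>lam y\<close>
  and \<open>lam z\<close>. Vectors \<open>a\<close>, \<open>b\<close>, \<open>c\<close> killed by
  \<open>y\<close>, \<open>z\<close> and \<open>y + z\<close> respectively are found first; if none
  of them works, their sum does.\<close>

lemma dual_triple:
  assumes V: "x \<in> V" "y \<in> V" "z \<in> V"
    and n: "stab x \<noteq> F" "stab (x + y) \<noteq> F" "stab (x + z) \<noteq> F" "stab (x + y + z) \<noteq> F"
  obtains d where "d \<in> F" "lam x d = 1" "lam y d = 0" "lam z d = 0"
proof -
  obtain a where a: "a \<in> F" "lam x a = 1" "lam y a = 0" using dual_pair V n by metis
  obtain b where b: "b \<in> F" "lam x b = 1" "lam z b = 0" using dual_pair V n by metis
  obtain c where c: "c \<in> F" "lam x c = 1" "lam (y + z) c = 0"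
    using dual_pair[of x "y + z"] V n by (auto simp: add.assoc)
  have c': "lam y c = lam z c" using c lam_add[of y z c] V by (cases "lam y c"; cases "lam z c") auto
  consider "lam z a = 0" | "lam y b = 0" | "lam y c = 0" | "lam z a = 1" "lam y b = 1" "lam y c = 1"
    by (metis bit_not_zero_iff)
  then show thesis
  proof cases
    case 4
    have F: "a + b + c \<in> F" using a b c by simp
    have "lam v (a + b + c) = lam v a + lam v b + lam v c" if "v \<in> V" for v
      using that a b c lam_add_right by simp
    then show thesis using that[OF F] a b c c' V 4 by simp
  qed (use that a b c c' in auto)
qed

section \<open>Vanishing of plane sums\<close>

text \<open>The points outside \<open>F\<close> pair up under translation by \<open>f\<close>, and
  the resulting values of \<open>lam\<close> at \<open>x\<close>, \<open>y\<close> and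
  \<open>x + y\<close> add to zero.\<close>

lemma plane_sum_F:
  assumes "f \<in> F" "x \<in> V" "y \<in> V"
  shows "plane_sum f x y = 0"
proof -
  have *: "f + x = x + f" "f + y = y + f" "f + x + y = x + y + f" "x + f + y = x + y + f" by (simp_all add: ac_simps)
  have "chi f = 0" using assms E_not_F by (auto simp: chi_def)
  then show ?thesis
    unfolding plane_sum_def * using assms by (simp add: chi_add_F lam_add)
qed

text \<open>Claw-freeness puts the total into \<open>E\<close>, making four points in all. The
  degenerate coincidences cancel directly.\<close>

lemma plane_sum_claw:
  assumes "chi x = 1" "chi y = 1" "chi z = 1" "chi (x + y) = 0" "chi (x + z) = 0" "chi (y + z) = 0"
  shows "plane_sum x y z = 0"
proof -
  have E: "x \<in> E" "y \<in> E" "z \<in> E" "x + y \<notin> E" "x + z \<notin> E" "y + z \<notin> E"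
    using assms by (auto simp: chi_def split: if_splits)
  show ?thesis
  proof (cases "x = y \<or> x = z \<or> y = z")
    case True
    moreover have "chi 0 = 0" using E_not_F[of 0] by (auto simp: chi_def)
    ultimately show ?thesis using assms by (auto simp: plane_sum_def ac_simps)
  next
    case False
    then have "x + y + z \<in> E" using no_claw[of x y z] E by auto
    then show ?thesis using assms by (simp add: plane_sum_def chi_def)
  qed
qed

text \<open>With dual vectors for the three functionals, the generators can be shifted inside their
  \<open>F\<close>-cosets until all three are in \<open>E\<close> and no pairwise sum is; then
  \<open>plane_sum_claw\<close> applies.\<close>

lemma plane_sum_independent:
  assumes V: "x \<in> V" "y \<in> V" "z \<in> V"
    and n: "stab x \<noteq> F" "stab y \<noteq> F" "stab z \<noteq> F" "stab (x + y) \<noteq> F" "stab (x + z) \<noteq> F" "stab (y + z) \<noteq> F"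
      "stab (x + y + z) \<noteq> F"
  shows "plane_sum x y z = 0"
proof -
  obtain d where d: "d \<in> F" "lam x d = 1" "lam y d = 0" "lam z d = 0"
    using dual_triple[OF V] n by metis
  obtain e where e: "e \<in> F" "lam y e = 1" "lam x e = 0" "lam z e = 0"
    using dual_triple[of y x z] V n by (auto simp: ac_simps)
  obtain k where k: "k \<in> F" "lam z k = 1" "lam x k = 0" "lam y k = 0"
    using dual_triple[of z x y] V n by (auto simp: ac_simps)
  \<comment> \<open>\<open>a\<close>, \<open>b\<close>, \<open>c\<close> are the values of
    \<open>lam\<close> that bring the generators into \<open>E\<close>. The remaining coefficients
    of \<open>g\<close> and \<open>h\<close> solve the equations making the pairwise sums 0.\<close>
  define a b c where "a = chi x + 1" and "b = chi y + 1" and "c = chi z + 1"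
  define f where "f = scale a d"
  define g where "g = scale b e + scale (chi (x + y) + a + b) d"
  define h where "h = scale c k + scale (chi (x + z) + a + c) d + scale (chi (y + z) + b + c) e"
  have F: "f \<in> F" "g \<in> F" "h \<in> F" using d e k by (simp_all add: f_def g_def h_def scale_F)
  have lf: "lam x f = a" "lam y f = 0" "lam z f = 0"
    using V d by (simp_all add: f_def lam_scale)
  have lg: "lam x g = chi (x + y) + a + b" "lam y g = b" "lam z g = 0"
    using V d e by (simp_all add: g_def lam_scale lam_add_right scale_F)
  have lh: "lam x h = chi (x + z) + a + c" "lam y h = chi (y + z) + b + c" "lam z h = c"
    using V d e k by (simp_all add: h_def lam_scale lam_add_right scale_F)
  have *: "x + f + (y + g) = x + y + (f + g)" "x + f + (z + h) = x + z + (f + h)"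
    "y + g + (z + h) = y + z + (g + h)"
    by (simp_all add: ac_simps)
  have "chi (x + f) = 1" "chi (y + g) = 1" "chi (z + h) = 1"
    "chi (x + f + (y + g)) = 0" "chi (x + f + (z + h)) = 0" "chi (y + g + (z + h)) = 0"
    unfolding * using V F
    by (simp_all add: chi_add_F lam_add lam_add_right lf lg lh)
      (simp_all add: a_def b_def c_def ac_simps)
  then have "plane_sum (x + f) (y + g) (z + h) = 0" by (rule plane_sum_claw)
  then show ?thesis using plane_sum_add_F V F by simp
qed

text \<open>Shifting \<open>q\<close> by \<open>h\<close> keeps it in \<open>E\<close>, since its
  functional is zero, while the values of \<open>lam x\<close> and \<open>lam y\<close> at
  \<open>h\<close> adjust the two sums with \<open>q\<close>.\<close>

lemma plane_sum_full:
  assumes V: "q \<in> V" "x \<in> V" "y \<in> V" and q: "q \<notin> F" "stab q = F"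
    and n: "stab x \<noteq> F" "stab y \<noteq> F" "stab (x + y) \<noteq> F"
  shows "plane_sum q x y = 0"
proof -
  obtain d where d: "d \<in> F" "lam x d = 1" "lam y d = 0"
    using dual_pair[of x y] V n by metis
  obtain e where e: "e \<in> F" "lam y e = 1" "lam x e = 0"
    using dual_pair[of y x] V n by (auto simp: ac_simps)
  define a b where "a = chi x + 1" and "b = chi y + 1"
  define f where "f = scale a d"
  define g where "g = scale b e + scale (chi (x + y) + a + b) d"
  define h where "h = scale (chi (q + x) + a) d + scale (chi (q + y) + b) e"
  have F: "f \<in> F" "g \<in> F" "h \<in> F" using d e by (simp_all add: f_def g_def h_def scale_F)
  have lf: "lam x f = a" "lam y f = 0"
    using V d by (simp_all add: f_def lam_scale)
  have lg: "lam x g = chi (x + y) + a + b" "lam y g = b"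
    using V d e by (simp_all add: g_def lam_scale lam_add_right scale_F)
  have lh: "lam x h = chi (q + x) + a" "lam y h = chi (q + y) + b"
    using V d e by (simp_all add: h_def lam_scale lam_add_right scale_F)
  have lq: "lam q f = 0" "lam q g = 0" "lam q h = 0" using q F lam_full by auto
  have cq: "chi q = 1" using full_in_E V q by (simp add: chi_def)
  have *: "x + f + (y + g) = x + y + (f + g)" "q + h + (x + f) = q + x + (h + f)"
    "q + h + (y + g) = q + y + (h + g)"
    by (simp_all add: ac_simps)
  have "chi (q + h) = 1" "chi (x + f) = 1" "chi (y + g) = 1"
    "chi (q + h + (x + f)) = 0" "chi (q + h + (y + g)) = 0" "chi (x + f + (y + g)) = 0"
    unfolding * using V F
    by (simp_all add: chi_add_F lam_add lam_add_right lf lg lh lq cq)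
      (simp_all add: a_def b_def ac_simps)
  then have "plane_sum (q + h) (x + f) (y + g) = 0" by (rule plane_sum_claw)
  then show ?thesis using plane_sum_add_F V F by simp
qed

lemma stab_full_add:
  assumes "q \<in> V" "x \<in> V" "stab q = F"
  shows "stab (q + x) = stab x"
  using stab_add[OF assms(1,2)] assms(3) stab_subset by blast

lemma other_stab:
  assumes "n \<in> V" "stab n \<noteq> F"
  obtains k where "k \<in> V" "stab k \<noteq> F" "stab (n + k) \<noteq> F"
proof -
  obtain x y where "x \<in> V" "y \<in> V" "stab x \<noteq> F" "stab y \<noteq> F" "stab x \<noteq> stab y"
    using two_stabs by blast
  then show thesis using that full_sum_iff[OF assms(1)] by metis
qed

text \<open>The values of \<open>chi\<close> at \<open>k + \<langle>q, r\<rangle>\<close> and \<open>n + k + \<langle>q, r\<rangle>\<close> cancel in the sum of three planes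
  that each contain exactly one element of \<open>{q, r, q + r}\<close>.\<close>

lemma coset_sum_full_full:
  assumes V: "q \<in> V" "r \<in> V" "n \<in> V" and F: "q \<notin> F" "r \<notin> F" "q + r \<notin> F"
    and full: "stab q = F" "stab r = F" and n: "stab n \<noteq> F"
  shows "chi n + chi (q + n) + chi (r + n) + chi (q + r + n) = 1"
proof -
  obtain k where k: "k \<in> V" "stab k \<noteq> F" "stab (n + k) \<noteq> F" using other_stab[OF V(3) n] .
  have qk: "stab (q + k) = stab k" using stab_full_add V k full by blast
  have nqk: "stab (n + (q + k)) \<noteq> F" using full_sum_iff[of n "q + k"] full_sum_iff[of n k] V k qk by simp
  have qr: "stab (q + r) = F" using stab_full_add[of q r] V full by simp
  have chi1: "chi q = 1" "chi r = 1" "chi (q + r) = 1" using full_in_E V F full qr by (auto simp: chi_def)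
  have 1: "plane_sum q n k = 0" using plane_sum_full[of q n k] V F full n k by simp
  have 2: "plane_sum (q + r) n k = 0" using plane_sum_full[of "q + r" n k] V F qr n k by simp
  have 3: "plane_sum r n (q + k) = 0" using plane_sum_full[of r n "q + k"] V F full n k qk nqk by simp
  have "chi n + chi (q + n) + chi (r + n) + chi (q + r + n) =
      plane_sum q n k + plane_sum (q + r) n k + plane_sum r n (q + k) + chi q + chi r + chi (q + r)"
    unfolding plane_sum_def by (simp add: ac_simps)
  then show ?thesis by (simp only: 1 2 3 chi1) simp
qed

text \<open>The three full points contribute 1, and so does the coset of their span through
  \<open>n\<close>.\<close>

lemma plane_sum_full_full:
  assumes V: "q \<in> V" "r \<in> V" "n \<in> V" and F: "q \<notin> F" "r \<notin> F" "q + r \<notin> F"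
    and full: "stab q = F" "stab r = F" and n: "stab n \<noteq> F"
  shows "plane_sum q r n = 0"
proof -
  have qr: "stab (q + r) = F" using stab_full_add[of q r] V full by simp
  have chi1: "chi q = 1" "chi r = 1" "chi (q + r) = 1" using full_in_E V F full qr by (auto simp: chi_def)
  have "plane_sum q r n =
      chi q + chi r + chi (q + r) + (chi n + chi (q + n) + chi (r + n) + chi (q + r + n))"
    unfolding plane_sum_def by (simp add: ac_simps)
  then show ?thesis by (simp only: coset_sum_full_full[OF assms] chi1) simp
qed

text \<open>Three coset sums, for the spans of \<open>q, s\<close> and \<open>q, r + s\<close>
  through \<open>n\<close> and of \<open>q, r\<close> through \<open>s + n\<close>, each equal 1.
  Together they contain every term twice, so they would add to 0.\<close>

lemma no_three_full:
  assumes V: "q \<in> V" "r \<in> V" "s \<in> V"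
    and F: "q \<notin> F" "r \<notin> F" "s \<notin> F" "q + r \<notin> F" "q + s \<notin> F" "r + s \<notin> F" "q + (r + s) \<notin> F"
    and full: "stab q = F" "stab r = F" "stab s = F"
  shows False
proof -
  obtain n where n: "n \<in> V" "stab n \<noteq> F" using two_stabs by auto
  have rs: "stab (r + s) = F" using stab_full_add[of r s] V full by simp
  have sn: "stab (s + n) \<noteq> F" using stab_full_add[of s n] V full n by simp
  have 1: "chi n + chi (q + n) + chi (s + n) + chi (q + s + n) = 1"
    by (rule coset_sum_full_full) (use V F full n in auto)
  have 2: "chi n + chi (q + n) + chi (r + s + n) + chi (q + (r + s) + n) = 1"
    by (rule coset_sum_full_full) (use V F full n rs in auto)
  have 3: "chi (s + n) + chi (q + (s + n)) + chi (r + (s + n)) + chi (q + r + (s + n)) = 1"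
    by (rule coset_sum_full_full) (use V F full n sn in auto)
  have "(chi n + chi (q + n) + chi (s + n) + chi (q + s + n)) +
    (chi n + chi (q + n) + chi (r + s + n) + chi (q + (r + s) + n)) +
    (chi (s + n) + chi (q + (s + n)) + chi (r + (s + n)) + chi (q + r + (s + n))) = 0"
    by (simp add: ac_simps)
  then show False by (simp only: 1 2 3) simp
qed

section \<open>Counting points in a plane\<close>

lemma plane_sum_card:
  assumes "distinct [0, x, y, z, x + y, x + z, y + z, x + y + z]"
  shows "plane_sum x y z = of_nat (card (E \<inter> {0, x, y, z, x + y, x + z, y + z, x + y + z}))"
proof -
  let ?P = "{0, x, y, z, x + y, x + z, y + z, x + y + z}"
  have "of_nat (card (E \<inter> ?P)) = (\<Sum>v\<in>?P. chi v)"
    using sum_of_bool_eq[of ?P "\<lambda>v. v \<in> E"] by (simp add: chi_def Int_commute)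
  also have "\<dots> = chi 0 + plane_sum x y z"
    using assms by (simp add: plane_sum_def add.assoc)
  finally show ?thesis using E_not_F[of 0] by (auto simp: chi_def)
qed

lemma eight_sums:
  assumes P: "subspace P" "card P = 8" and xyz: "x \<in> P" "y \<in> P" "z \<in> P"
    and ind: "x \<noteq> 0" "y \<noteq> 0" "x \<noteq> y" "z \<notin> {0, x, y, x + y}"
  shows "distinct [0, x, y, z, x + y, x + z, y + z, x + y + z]"
    "P = {0, x, y, z, x + y, x + z, y + z, x + y + z}"
proof -
  show d: "distinct [0, x, y, z, x + y, x + z, y + z, x + y + z]"
    using ind by (auto simp: add_eq_iff ac_simps)
  have "{0, x, y, z, x + y, x + z, y + z, x + y + z} \<subseteq> P"
    using xyz P(1) by (simp add: subspace_0 subspace_add)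
  moreover have "card (set [0, x, y, z, x + y, x + z, y + z, x + y + z]) = card P"
    using d P(2) by (subst distinct_card) simp_all
  moreover have "finite P" using P(2) card_gt_0_iff[of P] by simp
  ultimately show "P = {0, x, y, z, x + y, x + z, y + z, x + y + z}"
    by (metis card_subset_eq list.set(1,2))
qed

lemma obtain_outside:
  assumes "card P = 8" "finite A" "card A \<le> 4"
  obtains v where "v \<in> P" "v \<notin> A"
proof -
  have "\<not> P \<subseteq> A" using card_mono[OF assms(2), of P] assms by auto
  then show thesis using that by auto
qed

text \<open>If the plane meets \<open>F\<close> only in 0, the number of its points with full
  direction decides: none, exactly one, or two that leave some third generator not full by
  \<open>no_three_full\<close>.\<close>

lemma even_planes:
  assumes P: "subspace P" "card P = 8" "P \<subseteq> V"
  shows "even (card (E \<inter> P))"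
proof -
  have reduce: "even (card (E \<inter> P))"
    if "plane_sum x y z = 0" "x \<in> P" "y \<in> P" "z \<in> P" "x \<noteq> 0" "y \<noteq> 0" "x \<noteq> y" "z \<notin> {0, x, y, x + y}" for x y z
  proof -
    have "(of_nat (card (E \<inter> P)) :: bit) = 0"
      using plane_sum_card[OF eight_sums(1)[OF P(1,2) that(2-)]] that(1)
      unfolding eight_sums(2)[OF P(1,2) that(2-), symmetric] by simp
    then show ?thesis by (metis even_of_nat_iff even_zero)
  qed
  have P_add: "x + y \<in> P" if "x \<in> P" "y \<in> P" for x y using that P(1) subspace_add by blast
  have four: "card {a, b, c, d} \<le> 4" for a b c d :: 'v by (simp add: card_insert_if)
  show ?thesis
  proof (cases "\<exists>f\<in>P. f \<in> F \<and> f \<noteq> 0")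
    case True
    then obtain f where f: "f \<in> P" "f \<in> F" "f \<noteq> 0" by auto
    \<comment> \<open>The repeated zeros pad the set to be avoided, so that the bound
      \<open>four\<close> covers it.\<close>
    obtain x where x: "x \<in> P" "x \<notin> {0, f, 0, 0}" using obtain_outside[OF P(2) _ four] by blast
    obtain y where y: "y \<in> P" "y \<notin> {0, f, x, f + x}" using obtain_outside[OF P(2) _ four] by blast
    show ?thesis by (rule reduce[of f x y]) (use f x y plane_sum_F[of f x y] P(3) in auto)
  next
    case False
    then have nF: "v \<notin> F" if "v \<in> P" "v \<noteq> 0" for v using that by auto
    show ?thesis
    proof (cases "\<exists>q\<in>P. q \<noteq> 0 \<and> stab q = F")
      case True
      then obtain q where q: "q \<in> P" "q \<noteq> 0" "stab q = F" by auto
      show ?thesis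
      proof (cases "\<exists>r\<in>P. r \<noteq> 0 \<and> r \<noteq> q \<and> stab r = F")
        case True
        then obtain r where r: "r \<in> P" "r \<noteq> 0" "r \<noteq> q" "stab r = F" by auto
        obtain n where n: "n \<in> P" "n \<notin> {0, q, r, q + r}" using obtain_outside[OF P(2) _ four] by blast
        have nz: "q \<noteq> n" "r \<noteq> n" "q \<noteq> r + n"
          using n by (auto simp: ac_simps)
        have "stab n \<noteq> F"
        proof
          assume full: "stab n = F"
          show False
            by (rule no_three_full[of q r n])
              (use q r n full P(3) P_add nF nz in auto)
        qed
        then show ?thesis
          by (intro reduce[of q r n] plane_sum_full_full)
            (use q r n P(3) P_add nF in auto)
      next
        case False
        obtain x where x: "x \<in> P" "x \<notin> {0, q, 0, 0}" using obtain_outside[OF P(2) _ four] by blast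
        obtain y where y: "y \<in> P" "y \<notin> {0, q, x, q + x}" using obtain_outside[OF P(2) _ four] by blast
        have "x + y \<noteq> 0" "x + y \<noteq> q" using y by (auto simp: add_eq_iff ac_simps)
        then have "stab (x + y) \<noteq> F" using False P_add x y by blast
        then show ?thesis
          by (intro reduce[of q x y] plane_sum_full) (use q x y False P(3) nF in auto)
      qed
    next
      case False
      obtain x where x: "x \<in> P" "x \<notin> {0, 0, 0, 0}" using obtain_outside[OF P(2) _ four] by blast
      obtain y where y: "y \<in> P" "y \<notin> {0, x, 0, 0}" using obtain_outside[OF P(2) _ four] by blast
      obtain z where z: "z \<in> P" "z \<notin> {0, x, y, x + y}" using obtain_outside[OF P(2) _ four] by blast
      have "x + y \<noteq> 0" "x + z \<noteq> 0" "y + z \<noteq> 0" "x + y + z \<noteq> 0"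
        using y z by (auto simp: add_eq_iff ac_simps)
      then have "stab (x + y) \<noteq> F" "stab (x + z) \<noteq> F" "stab (y + z) \<noteq> F" "stab (x + y + z) \<noteq> F"
        using False P_add x y z by blast+
      then show ?thesis
        by (intro reduce[of x y z] plane_sum_independent) (use x y z False P(3) in auto)
    qed
  qed
qed

end

context maximal_disjoint_flat
begin

lemma stab_F: "v \<in> F \<Longrightarrow> stab v = F"
  using E_not_F F_add_iff(1) by (auto simp: stab_def)

end

section \<open>Recognising the hyperplane configuration\<close>

context incomparable_stabs
begin

lemma linear_stabsI:
  assumes V: "V = Q \<union> N" and ix: "\<And>n. n \<in> N \<Longrightarrow> index_two (stab n) F"
    and full: "\<And>q. q \<in> Q \<Longrightarrow> q \<notin> F \<Longrightarrow> stab q = F"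
  shows "linear_stabs scale V E F"
proof unfold_locales
  have stab_Q: "stab q = F" if "q \<in> Q" for q using full[OF that] stab_F by blast
  have add_iff: "f + g \<in> stab v \<longleftrightarrow> (f \<in> stab v \<longleftrightarrow> g \<in> stab v)" if "v \<in> V" "f \<in> F" "g \<in> F" for v f g
  proof (cases "v \<in> N")
    case True
    then show ?thesis
      using index_twoD[OF ix[OF True], of f g] subspace_add_iff[OF subspace_stab_N[OF True]] that by blast
  next
    case False
    then have "v \<in> Q" using V that by blast
    then show ?thesis using stab_Q that by simp
  qed
  show "v + f \<in> E \<longleftrightarrow> (v \<in> E \<longleftrightarrow> f \<in> stab v)" if v: "v \<in> V" and f: "f \<in> F" for v f
  proof (cases "v \<in> F")
    case True
    have "v \<notin> E" "v + f \<notin> E" using E_not_F True F_add[OF True f] by blast+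
    then show ?thesis using stab_F[OF True] f by simp
  next
    case False
    then obtain e where e: "e \<in> E" "e + v \<in> F" using maximal v by blast
    have "v \<in> E \<longleftrightarrow> e + v \<in> stab v" using stab_iff[OF e e(2)] by simp
    moreover have "v + f \<in> E \<longleftrightarrow> e + v + f \<in> stab v"
      using stab_iff[OF e F_add[OF e(2) f]] by (simp add: add.assoc)
    ultimately show ?thesis using add_iff[OF v e(2) f] by blast
  qed
  show "f \<in> stab (x + y) \<longleftrightarrow> (f \<in> stab x \<longleftrightarrow> f \<in> stab y)" if xy: "x \<in> V" "y \<in> V" and f: "f \<in> F" for x y f
  proof -
    consider "x \<in> Q" "y \<in> Q" | "x \<in> Q" "y \<in> N" | "x \<in> N" "y \<in> Q" | "x \<in> N" "y \<in> N"
      using xy V by auto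
    then show ?thesis
    proof cases
      case 1
      then show ?thesis using stab_Q subspace_add[OF subspace_Q 1] f by simp
    next
      case 2
      then show ?thesis using stab_Q[OF 2(1)] Q_N(2)[OF 2] f by simp
    next
      case 3
      then show ?thesis using stab_Q[OF 3(2)] Q_N(2)[OF 3(2,1)] f unfolding add.commute[of y x] by simp
    next
      case 4
      show ?thesis
      proof (cases "stab x = stab y")
        case True
        then show ?thesis using stab_Q[OF N_same[OF 4 True]] f True by simp
      next
        case ne: False
        note t = tri_incomparable[OF N_tri[OF 4 ne] N_incomparable[OF 4 ne]]
        obtain a where a: "a \<in> stab x" "a \<notin> stab y" using N_incomparable[OF 4 ne] by auto
        have aF: "a \<in> F" using a stab_subset by auto
        show ?thesis
        proof (cases "f \<in> stab x \<or> f \<in> stab y")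
          case True
          then show ?thesis using t(1,2) by blast
        next
          case False
          \<comment> \<open>\<open>f\<close> outside both hyperplanes is the sum of \<open>a\<close>
            in \<open>stab x - stab y\<close> and \<open>a + f\<close> in
            \<open>stab y - stab x\<close>, hence lies in the third one.\<close>
          have "a + f \<in> stab y" using add_iff[of y a f] xy a aF f False by auto
          moreover have "a + f \<notin> stab x" using add_iff[of x a f] xy a aF f False by auto
          ultimately have "a + (a + f) \<in> stab (x + y)" using t(6)[OF a] by blast
          then show ?thesis using False by simp
        qed
      qed
    qed
  qed
  show "q \<in> E" if q: "q \<in> V" "q \<notin> F" "stab q = F" for q
  proof -
    obtain e where e: "e \<in> E" "e + q \<in> F" using maximal q by blast
    then show ?thesis using stab_iff[OF e e(2)] q by simp
  qed
  show "\<exists>x\<in>V. \<exists>y\<in>V. stab x \<noteq> F \<and> stab y \<noteq> F \<and> stab x \<noteq> stab y"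
  proof -
    obtain n where n: "n \<in> N" using N_nonempty by auto
    obtain n' where n': "n' \<in> N" "stab n' \<noteq> stab n" using N_other[OF n] .
    show ?thesis using n n' stab_N_neq_F N_D(1) by metis
  qed
qed

text \<open>Distinct directions meet in a subspace of index two in each. Such a family either lies
  in a space only one dimension larger, or shares a common intersection of index two. The latter is
  contained in \<open>J = {0}\<close>, which would give \<open>m = 2\<close>.\<close>

lemma hyperplanes_if_not_lines:
  assumes high: "\<And>v. \<not> high v" and F: "F = (\<Union>n\<in>N. stab n)" and J: "J = {0}" and m: "m \<noteq> 2"
  shows "V = Q \<union> N" "n \<in> N \<Longrightarrow> index_two (stab n) F"
proof -
  have not_zero: "\<not> index_two {0} (stab n)" if n: "n \<in> N" for n
  proof
    assume "index_two {0} (stab n)"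
    from card_index_two[OF this _ subspace_stab_N[OF n] finite_stab] show False
      using m N_D(3)[OF n] by simp
  qed
  have "v \<in> Q \<union> N" if "v \<in> V" for v
  proof (rule ccontr)
    assume v: "v \<notin> Q \<union> N"
    have "low v" using that by (cases rule: cases_V) (use v high F_Q in auto)
    moreover obtain n where "n \<in> N" using N_nonempty by auto
    ultimately show False using low_outside(1,2)[of v] v not_zero J by metis
  qed
  then show "V = Q \<union> N" using Q_V N_D(1) by auto
  show "index_two (stab n1) F" if n1: "n1 \<in> N" for n1
  proof (rule ccontr)
    assume "\<not> index_two (stab n1) F"
    moreover have "stab n1 \<subset> F" using stab_subset stab_N_neq_F[OF n1] by auto
    ultimately obtain f g where fg: "f \<in> F" "f \<notin> stab n1" "g \<in> F" "g \<notin> stab n1" "f + g \<notin> stab n1"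
      by (auto simp: index_two_def)
    obtain n2 where n2: "n2 \<in> N" "f \<in> stab n2" using fg F by auto
    obtain n3 where n3: "n3 \<in> N" "g \<in> stab n3" using fg F by auto
    have ne: "stab n1 \<noteq> stab n2" using n2 fg by auto
    note T = N_tri[OF n1 n2(1) ne] and i = N_incomparable[OF n1 n2(1) ne]
    note t = tri_incomparable[OF T i]
    define S where "S = stab n1 \<union> stab n2 \<union> stab (n1 + n2)"
    have sS: "subspace S" using t(8) by (simp add: S_def)
    have ab: "absorbs (stab n2) (stab (n1 + n2)) (stab n1)" using T by (simp add: tri_def)
    \<comment> \<open>\<open>g\<close> shows that the directions are not all inside
      \<open>S\<close>: absorption by \<open>stab n1\<close> would put \<open>g\<close> or
      \<open>f + g\<close> into \<open>stab n1\<close>.\<close>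
    have gS: "g \<notin> S"
    proof
      assume "g \<in> S"
      moreover have "f \<notin> stab (n1 + n2)" using t(2) n2 fg by blast
      ultimately have "g \<in> stab n1 \<or> f + g \<in> stab n1" using absorbsD[OF ab n2(2)] by (auto simp: S_def)
      then show False using fg by simp
    qed
    have Int_ix: "x + y \<in> stab n \<inter> stab n'"
      if "n \<in> N" "n' \<in> N" "x \<in> stab n" "x \<notin> stab n'" "y \<in> stab n" "y \<notin> stab n'" for n n' x y
    proof -
      have "stab n \<noteq> stab n'" using that by auto
      then show ?thesis
        using tri_incomparable(3)[OF N_tri N_incomparable] index_twoD[of "stab n \<inter> stab n'" "stab n" x y] that
        by blast
    qed
    have out: "stab n1 \<inter> stab n2 \<subseteq> stab n" if n: "n \<in> N" "\<not> stab n \<subseteq> S" for n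
    proof
      obtain g' where g': "g' \<in> stab n" "g' \<notin> S" using n by auto
      \<comment> \<open>If \<open>x\<close> were not in \<open>stab n'\<close>, then
        \<open>x + g'\<close> would be in \<open>stab n'\<close>, hence in \<open>S\<close>, and so
        would \<open>g'\<close>.\<close>
      have DS: "x \<in> stab n'" if x: "x \<in> stab n" "x \<in> S" and n': "n' \<in> N" "stab n' \<subseteq> S" for x n'
      proof (rule ccontr)
        assume "x \<notin> stab n'"
        then have "x + g' \<in> S" using Int_ix[OF n(1) n'(1) x(1) _ g'(1)] g' n' by auto
        then show False using x g' sS subspace_add_iff by blast
      qed
      have S12: "stab n1 \<subseteq> S" "stab n2 \<subseteq> S" by (auto simp: S_def)
      fix h assume h: "h \<in> stab n1 \<inter> stab n2"
      show "h \<in> stab n"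
      proof (rule ccontr)
        assume hn: "h \<notin> stab n"
        obtain k where k: "k \<in> stab n1" "k \<notin> stab n2" using i by auto
        have "k \<notin> stab n" using DS[of k n2] k S12 n2 by auto
        then have "h + k \<in> stab n1 \<inter> stab n" using Int_ix[OF n1 n(1) _ hn k(1)] h by auto
        then have "h + k \<in> stab n2" using DS[of "h + k" n2] S12 n2 by auto
        then show False using h k subspace_add_iff(2)[OF subspace_stab_N[OF n2(1)]] by auto
      qed
    qed
    have "stab n1 \<inter> stab n2 \<subseteq> stab n" if n: "n \<in> N" for n
    proof (cases "stab n \<subseteq> S")
      case True
      show ?thesis
      proof
        fix h assume h: "h \<in> stab n1 \<inter> stab n2"
        \<comment> \<open>A direction inside \<open>S\<close> is compared with
          \<open>stab n3\<close>, which leaves \<open>S\<close> at \<open>g\<close>.\<close>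
        have h3: "h \<in> stab n3" using out[OF n3(1)] n3 gS h by auto
        show "h \<in> stab n"
        proof (rule ccontr)
          assume "h \<notin> stab n"
          then have "h + g \<in> stab n" using Int_ix[OF n3(1) n h3 _ n3(2)] True gS by auto
          then have "h + g \<in> S" using True by auto
          moreover have "h \<in> S" using h by (auto simp: S_def)
          ultimately show False using gS sS subspace_add_iff by blast
        qed
      qed
    qed (rule out[OF n])
    then have "stab n1 \<inter> stab n2 \<subseteq> J" unfolding J_def by (rule INT_greatest)
    then have "stab n1 \<inter> stab n2 \<subseteq> {0}" using J by simp
    then have "stab n1 \<inter> stab n2 = {0}"
      using subspace_0[OF subspace_stab_N] n1 n2(1) by blast
    then show False using t(3) not_zero[OF n1] by simp
  qed
qed

end

section \<open>Strict PG-sums\<close>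

locale line_stabs = incomparable_stabs scale V E F m
  for scale :: "bit \<Rightarrow> 'v::ab_group_add \<Rightarrow> 'v" and V E F m +
  assumes m_eq: "m = 2"
    and Q_eq: "Q = F"
    and stab_outside: "\<And>v. v \<in> V \<Longrightarrow> v \<notin> F \<Longrightarrow> v \<notin> N \<Longrightarrow> stab v = {0}"
begin

text \<open>The nonzero vector of a direction of size two.\<close>

definition phi :: "'v \<Rightarrow> 'v" where
  "phi n = (SOME a. a \<noteq> 0 \<and> stab n = {0, a})"

lemma phi:
  assumes "n \<in> N"
  shows "phi n \<noteq> 0" "stab n = {0, phi n}"
proof -
  obtain a b where ab: "stab n = {a, b}" "a \<noteq> b"
    using N_D(3)[OF assms] m_eq card_2_iff by metis
  moreover have "0 \<in> stab n" using subspace_0[OF subspace_stab_N[OF assms]] .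
  ultimately have "\<exists>a. a \<noteq> 0 \<and> stab n = {0, a}" by auto
  then show "phi n \<noteq> 0" "stab n = {0, phi n}"
    unfolding phi_def by (rule someI2_ex; simp)+
qed

lemma phi_F: "n \<in> N \<Longrightarrow> phi n \<in> F"
  using phi(2)[of n] stab_subset[of n] by auto

lemma subspace_F_N: "subspace (F \<union> N)"
  using subspace_Q_N by (simp add: Q_eq)

lemma F_N_add_iff: "n \<in> F \<union> N \<Longrightarrow> v + n \<in> F \<union> N \<longleftrightarrow> v \<in> F \<union> N" "n \<in> F \<union> N \<Longrightarrow> n + v \<in> F \<union> N \<longleftrightarrow> v \<in> F \<union> N"
  using subspace_add_iff[OF subspace_F_N] by blast+

text \<open>Equal directions in \<open>N\<close> differ by an element of \<open>Q = F\<close>, so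
  here they are distinct, and the sum of their nonzero vectors lies in the third direction.\<close>

lemma phi_add:
  assumes "n \<in> N" "n' \<in> N" "n + n' \<notin> F"
  shows "n + n' \<in> N" "phi n \<noteq> phi n'" "phi (n + n') = phi n + phi n'"
proof -
  have ne: "stab n \<noteq> stab n'" using N_same assms Q_eq by blast
  then show "phi n \<noteq> phi n'" using phi(2)[OF assms(1)] phi(2)[OF assms(2)] by auto
  show nN: "n + n' \<in> N" using N_sum(1)[OF assms(1,2) ne] .
  have "phi n + phi n' \<in> stab (n + n')"
    using tri_incomparable(6)[OF N_tri[OF assms(1,2) ne] N_incomparable[OF assms(1,2) ne], of "phi n" "phi n'"]
      phi[OF assms(1)] phi[OF assms(2)] \<open>phi n \<noteq> phi n'\<close> by auto
  then show "phi (n + n') = phi n + phi n'"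
    using phi(2)[OF nN] \<open>phi n \<noteq> phi n'\<close> by auto
qed

section \<open>The matching relation on the ground set\<close>

text \<open>In a strict PG-sum this is the relation of lying in the same flat.\<close>

definition matched :: "'v \<Rightarrow> 'v \<Rightarrow> bool" where
  "matched x y \<longleftrightarrow> x = y \<or> x + y \<in> E"

lemma matched_sym: "matched x y \<longleftrightarrow> matched y x"
  by (auto simp: matched_def add.commute)

lemma antipode_E:
  assumes "e \<in> E" "e \<in> N"
  shows "e + phi e \<in> E" "e + phi e \<in> N" "phi (e + phi e) = phi e" "e + phi e + phi e = e"
proof -
  show E: "e + phi e \<in> E" using stab_E[of e "phi e"] phi[OF assms(2)] phi_F assms by auto
  have st: "stab (e + phi e) = stab e" using stab_add_F phi_F assms(2) by blast
  then show "phi (e + phi e) = phi e" by (simp add: phi_def)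
  show "e + phi e \<in> N" using st N_D(3)[OF assms(2)] E E_V E_not_F unfolding N_def by auto
qed simp

text \<open>\<open>e\<close> and \<open>e + phi e\<close> are the two points of \<open>E\<close> in
  their \<open>F\<close>-coset. Outside that coset, \<open>s\<close> measures \<open>x + e\<close>
  against a point of \<open>E\<close>; it lies in one of three directions, and modulo
  \<open>stab (x + e)\<close> exactly one of \<open>s\<close> and \<open>s + phi e\<close>
  vanishes.\<close>

lemma matched_antipode:
  assumes x: "x \<in> E" and e: "e \<in> E" "e \<in> N"
  shows "matched x (e + phi e) \<longleftrightarrow> \<not> matched x e"
proof (cases "x + e \<in> F")
  case True
  then have "e + (x + e) \<in> E" using x by (simp add: ac_simps)
  then have "x + e \<in> stab e" using stab_E[OF e(1) True] by simp
  then have "x + e = 0 \<or> x + e = phi e" using phi(2)[OF e(2)] by auto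
  then have "x = e \<or> x = e + phi e" by (metis add_eq_0_iff_eq add_self_right add.commute)
  moreover have "phi e \<notin> E" using phi_F[OF e(2)] E_not_F by auto
  ultimately show ?thesis
    using phi(1)[OF e(2)] by (auto simp: matched_def ac_simps)
next
  case False
  have xe: "x + e \<in> V" using x e E_V by auto
  then obtain e3 where e3: "e3 \<in> E" "e3 + (x + e) \<in> F" using maximal[OF _ False] by auto
  define s where "s = x + e + e3"
  have sF: "s \<in> F" using e3 by (simp add: s_def ac_simps)
  have st3: "stab e3 = stab (x + e)" using stab_cong e3(2) by blast
  have s: "s \<in> stab x \<union> stab e \<union> stab (x + e)"
    using sum_in_Un_stab[OF x e(1) e3(1)] sF st3 by (simp add: s_def)
  have pF: "phi e \<in> F" using phi_F e by auto
  have 1: "x + e \<in> E \<longleftrightarrow> s \<in> stab (x + e)"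
    using stab_E[OF e3(1) sF] st3 by (simp add: s_def ac_simps)
  have 2: "x + (e + phi e) \<in> E \<longleftrightarrow> s + phi e \<in> stab (x + e)"
    using stab_E[OF e3(1) F_add[OF sF pF]] st3 by (simp add: s_def ac_simps)
  have "x \<noteq> e" "x \<noteq> e + phi e" using False pF by (auto simp: ac_simps)
  then have m: "matched x e \<longleftrightarrow> s \<in> stab (x + e)" "matched x (e + phi e) \<longleftrightarrow> s + phi e \<in> stab (x + e)"
    using 1 2 by (auto simp: matched_def)
  have pe: "stab e = {0, phi e}" "phi e \<noteq> 0" using phi e by auto
  show ?thesis
  proof (cases "x \<in> N")
    case True
    note pa = phi_add[OF True e(2) False]
    have "stab (x + e) = {0, phi x + phi e}" "stab x = {0, phi x}" "phi x \<noteq> 0"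
      using phi[OF pa(1)] phi[OF True] pa(3) by auto
    then show ?thesis using m s pe pa(2) by (auto simp: add_eq_iff)
  next
    case F: False
    then have "x + e \<notin> F \<union> N" using F_N_add_iff(1)[of e x] e x E_not_F by auto
    then have "stab (x + e) = {0}" "stab x = {0}" using stab_outside xe F x E_V E_not_F by auto
    then show ?thesis using m s pe by auto
  qed
qed

text \<open>Two of the three directions are zero, so the deviation of \<open>x + y\<close> from a
  point of \<open>E\<close> in its coset lies in the direction of that coset.\<close>

lemma matched_outside:
  assumes "x \<in> E" "y \<in> E" "x \<notin> N" "y \<notin> N"
  shows "matched x y"
proof (cases "x + y \<in> F")
  case True
  then have "x + y \<in> stab x" using stab_E[of x "x + y"] assms by simp
  then have "x + y \<in> {0}" using stab_outside[of x] assms E_V E_not_F by auto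
  then show ?thesis by (auto simp: matched_def)
next
  case False
  obtain e3 where e3: "e3 \<in> E" "e3 + (x + y) \<in> F" using maximal[OF _ False] assms E_V by auto
  have F: "x + y + e3 \<in> F" using e3 by (simp add: ac_simps)
  have "stab x = {0}" "stab y = {0}" using stab_outside assms E_V E_not_F by auto
  moreover have "0 \<in> stab e3" using subspace_0[OF subspace_stab[OF E_V[OF e3(1)] E_not_F[OF e3(1)]]] .
  ultimately have "x + y + e3 \<in> stab e3" using sum_in_Un_stab[OF assms(1,2) e3(1) F] by auto
  then have "e3 + (x + y + e3) \<in> E" using stab_E[OF e3(1) F] by simp
  then show ?thesis by (simp add: matched_def ac_simps)
qed

lemma sum_outside: "x \<in> N \<Longrightarrow> y \<in> E \<Longrightarrow> y \<notin> N \<Longrightarrow> x + y \<notin> N"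
  using F_N_add_iff(2)[of x y] E_not_F[of y] by auto

text \<open>\<open>x + y\<close> and \<open>z + y\<close> are in \<open>E\<close> and outside
  \<open>N\<close>, hence matched to each other, and their sum is \<open>x + z\<close>.\<close>

lemma matched_via_outside:
  assumes "x \<in> E" "y \<in> E" "z \<in> E" "x \<in> N" "y \<notin> N" "z \<in> N" and m: "matched x y" "matched y z"
  shows "matched x z"
proof -
  have E: "x + y \<in> E" "z + y \<in> E" using m assms by (auto simp: matched_def add.commute)
  have "x + y \<notin> N" "z + y \<notin> N" using sum_outside assms by auto
  then have "matched (x + y) (z + y)" using matched_outside E by blast
  moreover have "x + y + (z + y) = x + z" by (simp add: ac_simps)
  ultimately show ?thesis unfolding matched_def by (metis add_eq_0_iff_eq)
qed

text \<open>Otherwise the antipode of \<open>x\<close> is matched to \<open>z\<close>, and through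
  \<open>z\<close> to \<open>y\<close>, which is already matched to \<open>x\<close>.\<close>

lemma matched_to_outside:
  assumes "x \<in> E" "y \<in> E" "z \<in> E" "x \<in> N" "y \<in> N" "z \<notin> N" and m: "matched x y" "matched y z"
  shows "matched x z"
proof (rule ccontr)
  assume "\<not> matched x z"
  then have "matched (x + phi x) z"
    using matched_antipode[OF assms(3,1,4)] matched_sym by blast
  then have "matched (x + phi x) y"
    using matched_via_outside[of "x + phi x" z y] antipode_E[OF assms(1,4)] assms matched_sym by blast
  then show False using matched_antipode[OF assms(2,1,4)] m matched_sym by blast
qed

text \<open>\<open>d = y + z\<close> is in \<open>E\<close>. If it is in \<open>N\<close>, pass from
  \<open>x\<close> through \<open>y\<close> to \<open>d\<close> and on to \<open>z\<close>;
  otherwise \<open>x + y\<close> and \<open>d\<close> are both outside \<open>N\<close>, hence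
  matched.\<close>

lemma matched_two_outside:
  assumes "x \<in> E" "y \<in> E" "z \<in> E" "x \<in> N" "y \<notin> N" "z \<notin> N" and m: "matched x y"
  shows "matched x z"
proof (cases "y = z")
  case False
  define d where "d = y + z"
  have d: "d \<in> E" using matched_outside[OF assms(2,3,5,6)] False by (auto simp: d_def matched_def)
  have yz: "d + y = z" "d + z = y" "y + d = z" by (simp_all add: d_def ac_simps)
  show ?thesis
  proof (cases "d \<in> N")
    case True
    have "matched y d" "matched d z" using yz assms by (auto simp: matched_def)
    then have "matched x d" using matched_via_outside[of x y d] True d assms by blast
    then show ?thesis using matched_to_outside[of x d z] \<open>matched d z\<close> True d assms by blast
  next
    case dN: False
    have "x + y \<in> E" using m assms by (auto simp: matched_def)
    moreover have "x + y \<notin> N" using sum_outside assms by blast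
    ultimately have "matched (x + y) d" using matched_outside d dN by blast
    moreover have "x + y + d = x + z" by (simp add: d_def ac_simps)
    ultimately show ?thesis unfolding matched_def by (metis add_eq_0_iff_eq)
  qed
qed (use m in simp)

text \<open>If transitivity fails, the antipode of \<open>x\<close> is matched to \<open>z\<close>.
  Applying \<open>matched_antipode\<close> to \<open>x + y\<close>, \<open>y + z\<close> and
  \<open>x + phi x + z\<close> determines which shifts of \<open>s = x + y + z\<close> are in
  \<open>E\<close>, and these contradict the direction of \<open>s\<close>.\<close>

lemma matched_inside:
  assumes E: "x \<in> E" "y \<in> E" "z \<in> E" and N: "x \<in> N" "y \<in> N" "z \<in> N" and m: "matched x y" "matched y z"
  shows "matched x z"
proof (rule ccontr)
  assume n: "\<not> matched x z"
  then have ne: "x \<noteq> y" "y \<noteq> z" using m by auto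
  then have E2: "x + y \<in> E" "y + z \<in> E" using m by (auto simp: matched_def)
  have F2: "x + y \<notin> F" "y + z \<notin> F" using E2 E_not_F by auto
  note xy = phi_add[OF N(1,2) F2(1)] and yz = phi_add[OF N(2,3) F2(2)]
  have pz: "phi x \<noteq> 0" "phi y \<noteq> 0" "phi z \<noteq> 0" using phi N by auto
  have m': "matched (x + phi x) z" using matched_antipode[OF E(3,1) N(1)] n matched_sym by blast
  have F3: "x + z \<notin> F"
  proof
    assume "x + z \<in> F"
    then have "x + z \<in> stab x" using stab_E[OF E(1), of "x + z"] E by simp
    then have "x + z = 0 \<or> x + z = phi x" using phi(2)[OF N(1)] by auto
    then have "x = z \<or> z = x + phi x" by (metis add_eq_0_iff_eq add_self_left)
    then show False using n m matched_antipode[OF E(2,1) N(1)] matched_sym by (auto simp: matched_def)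
  qed
  note xz = phi_add[OF N(1,3) F3]
  define s where "s = x + y + z"
  show False
  proof (cases "s \<in> F")
    case True
    have "x + y + s = z" by (simp add: s_def ac_simps)
    \<comment> \<open>Here \<open>x + y\<close> and \<open>z\<close> are points of \<open>E\<close>
      in the same \<open>F\<close>-coset.\<close>
    then have "s \<in> stab (x + y)" using stab_E[OF E2(1) True] E by simp
    then have "s = 0 \<or> s = phi x + phi y" using phi(2)[OF xy(1)] xy(3) by auto
    moreover have "y + s = x + z" "x + s = y + z" by (simp_all add: s_def ac_simps)
    ultimately consider "y = x + z" | "x + (phi x + phi y) \<in> E" using E2 by auto
    then show False
    proof cases
      case 1
      then show False using n E by (auto simp: matched_def)
    next
      case 2
      then have "phi x + phi y \<in> stab x" using stab_E[OF E(1)] phi_F N by auto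
      then show False using phi(2)[OF N(1)] xy pz by (auto simp: add_eq_iff)
    qed
  next
    case False
    have s1: "s = x + (y + z)" by (simp add: s_def add.assoc)
    note ps = phi_add[OF N(1) yz(1) False[unfolded s1]]
    have phis: "stab s = {0, phi x + (phi y + phi z)}"
      using ps yz(3) phi(2)[OF ps(1)] by (simp add: s1)
    have nF: "v + w \<noteq> 0" if "v + w + s \<in> F" for v w using that False by auto
    have m_iff: "matched v w \<longleftrightarrow> v + w \<in> E" if "v + w + s \<in> F" for v w
      using nF[OF that] by (auto simp: matched_def)
    have F: "phi x \<in> F" "phi y \<in> F" "phi z \<in> F" using phi_F N by auto
    have sums: "x + y + z = s" "x + y + (z + phi z) = s + phi z" "y + z + x = s"
      "y + z + (x + phi x) = s + phi x" "x + phi x + z + y = s + phi x"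
      "x + phi x + z + (y + phi y) = s + (phi x + phi y)"
      by (simp_all add: s_def ac_simps)
    have shift: "s + f + s = f" for f by (simp add: ac_simps)
    have E3: "x + phi x + z \<in> E"
    proof -
      have "x + phi x \<noteq> z"
      proof
        assume "x + phi x = z"
        then have "x + z = phi x" by (simp add: add_eq_iff)
        then show False using F3 F by simp
      qed
      then show ?thesis using m' by (auto simp: matched_def)
    qed
    have a1: "s + phi z \<in> E \<longleftrightarrow> s \<notin> E"
      using matched_antipode[OF E2(1) E(3) N(3)] m_iff[of "x + y" z] m_iff[of "x + y" "z + phi z"] F
      unfolding sums shift by simp
    have a2: "s + phi x \<in> E \<longleftrightarrow> s \<notin> E"
      using matched_antipode[OF E2(2) E(1) N(1)] m_iff[of "y + z" x] m_iff[of "y + z" "x + phi x"] F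
      unfolding sums shift by simp
    have a3: "s + (phi x + phi y) \<in> E \<longleftrightarrow> s + phi x \<notin> E"
      using matched_antipode[OF E3 E(2) N(2)] m_iff[of "x + phi x + z" y] m_iff[of "x + phi x + z" "y + phi y"] F
      unfolding sums shift by simp
    show False
    proof (cases "s \<in> E")
      case True
      then have "phi x + phi y \<in> stab s" using a2 a3 stab_E[OF True] F by auto
      then show False using phis xy pz by (auto simp: add_eq_iff)
    next
      case sE: False
      have e: "s + phi z \<in> E" "s + phi z + (phi x + phi z) \<in> E"
        using a1 a2 sE by (simp_all add: ac_simps)
      have "stab (s + phi z) = stab s" using stab_add_F F by blast
      then have "phi x + phi z \<in> stab s" using stab_E[OF e(1), of "phi x + phi z"] e F by simp
      then show False using phis xz pz by (auto simp: add_eq_iff)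
    qed
  qed
qed

lemma matched_trans:
  assumes "x \<in> E" "y \<in> E" "z \<in> E" and m: "matched x y" "matched y z"
  shows "matched x z"
proof -
  note s = matched_sym
  consider "x \<in> N" "y \<in> N" "z \<in> N" | "x \<in> N" "y \<in> N" "z \<notin> N" | "x \<in> N" "y \<notin> N" "z \<in> N" | "x \<in> N" "y \<notin> N" "z \<notin> N"
    | "x \<notin> N" "y \<in> N" "z \<in> N" | "x \<notin> N" "y \<notin> N" "z \<in> N" | "x \<notin> N" "z \<notin> N" by blast
  then show ?thesis
  proof cases
    case 1 then show ?thesis using matched_inside assms by blast
  next
    case 2 then show ?thesis using matched_to_outside assms by blast
  next
    case 3 then show ?thesis using matched_via_outside assms by blast
  next
    case 4 then show ?thesis using matched_two_outside assms by blast
  next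
    case 5 then show ?thesis using matched_to_outside[of z y x] assms s by blast
  next
    case 6 then show ?thesis using matched_two_outside[of z y x] assms s by blast
  next
    case 7 then show ?thesis using matched_outside assms by blast
  qed
qed

text \<open>For \<open>x\<close> in \<open>N\<close>, both other points are matched to the antipode
  of \<open>x\<close>. Otherwise they lie in \<open>N\<close>, their antipodes are matched to
  \<open>x\<close>, and passing back to the points flips the relation twice.\<close>

lemma two_classes:
  assumes E: "x \<in> E" "y \<in> E" "z \<in> E" and n: "\<not> matched x y" "\<not> matched x z"
  shows "matched y z"
proof (cases "x \<in> N")
  case True
  let ?x = "x + phi x"
  have x': "?x \<in> E" using antipode_E E True by blast
  have "matched y ?x" "matched z ?x" using matched_antipode[OF _ E(1) True] E n matched_sym by blast+
  then show ?thesis using matched_trans[OF E(2) x' E(3)] matched_sym by blast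
next
  case False
  then have N: "y \<in> N" "z \<in> N" using matched_outside E n by blast+
  let ?y = "y + phi y" and ?z = "z + phi z"
  have E': "?y \<in> E" "?z \<in> E" using antipode_E E N by blast+
  have "matched x ?y" "matched x ?z" using matched_antipode E N n by blast+
  then have "matched ?y ?z" using matched_trans[OF E'(1) E(1) E'(2)] matched_sym by blast
  then show ?thesis
    using matched_antipode[OF E'(1) E(3) N(2)] matched_antipode[OF E(3,2) N(1)] matched_sym by blast
qed

lemma matched_add:
  assumes "x \<in> E" "y \<in> E" "matched x y" "x \<noteq> y"
  shows "x + y \<in> E" "matched (x + y) x"
  using assms by (auto simp: matched_def ac_simps)

text \<open>The sum of two distinct matched points is in \<open>E\<close> and matched to both, so
  each class together with 0 is a subspace.\<close>

lemma two_flats: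
  "\<exists>A B. subspace A \<and> subspace B \<and> A \<inter> B = {0} \<and> A \<noteq> {0} \<and> B \<noteq> {0} \<and> E = A \<union> B - {0}"
proof -
  obtain n where n: "n \<in> N" using N_nonempty by auto
  obtain e where e: "e \<in> E" "e + n \<in> F" using maximal[OF N_D(1)[OF n] N_D(2)[OF n]] by auto
  have "e + n + n \<in> F \<union> N" using F_N_add_iff(1)[of n "e + n"] e n by blast
  \<comment> \<open>Choosing \<open>e\<close> in \<open>N\<close> gives it an antipode, which makes
    the second class nonempty.\<close>
  then have eN: "e \<in> N" using E_not_F[OF e(1)] by auto
  define A where "A = insert 0 {x \<in> E. matched e x}"
  define B where "B = insert 0 {x \<in> E. \<not> matched e x}"
  have E0: "0 \<notin> E" using E_not_F zero_F by blast
  have "x + y \<in> A" if "x \<in> A" "y \<in> A" for x y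
  proof (cases "x = 0 \<or> y = 0 \<or> x = y")
    case False
    then have xy: "x \<in> E" "y \<in> E" "matched e x" "matched e y" "x \<noteq> y" using that by (auto simp: A_def)
    then have "matched x y" using matched_trans[of x e y] e matched_sym by blast
    note * = matched_add[OF xy(1,2) this xy(5)]
    have "matched e (x + y)" using matched_trans[OF e(1) xy(1) *(1) xy(3)] * matched_sym by blast
    then show ?thesis using * by (simp add: A_def)
  qed (use that in \<open>auto simp: A_def\<close>)
  then have "subspace A" unfolding subspace_iff by (auto simp: A_def)
  moreover have "x + y \<in> B" if "x \<in> B" "y \<in> B" for x y
  proof (cases "x = 0 \<or> y = 0 \<or> x = y")
    case False
    then have xy: "x \<in> E" "y \<in> E" "\<not> matched e x" "\<not> matched e y" "x \<noteq> y" using that by (auto simp: B_def)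
    then have "matched x y" using two_classes[of e x y] e by blast
    note * = matched_add[OF xy(1,2) this xy(5)]
    have "\<not> matched e (x + y)" using matched_trans[OF e(1) *(1) xy(1)] * xy by blast
    then show ?thesis using * by (simp add: B_def)
  qed (use that in \<open>auto simp: B_def\<close>)
  then have "subspace B" unfolding subspace_iff by (auto simp: B_def)
  moreover have "A \<inter> B = {0}" by (auto simp: A_def B_def)
  moreover have "e \<in> A" using e by (simp add: A_def matched_def)
  then have "A \<noteq> {0}" using e E0 by auto
  moreover have "e + phi e \<in> B"
    using antipode_E[OF e(1) eN] matched_antipode[OF e(1) e(1) eN] by (auto simp: B_def matched_def)
  then have "B \<noteq> {0}" using antipode_E[OF e(1) eN] E0 by auto
  moreover have "E = A \<union> B - {0}" using E0 by (auto simp: A_def B_def)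
  ultimately show ?thesis by blast
qed

end

section \<open>The decomposition theorem\<close>

context incomparable_stabs
begin

text \<open>Each \<open>f\<close> in \<open>F\<close> lies in some direction, so it is the sum of
  two points \<open>e\<close> and \<open>e + f\<close> of \<open>E\<close>; any other vector differs
  from a point of \<open>E\<close> by an element of \<open>F\<close>.\<close>

lemma span_E_if_Union:
  assumes "F = (\<Union>n\<in>N. stab n)"
  shows "span E = V"
proof
  show "span E \<subseteq> V" using span_minimal[OF E_subset subspace_V] .
  have F: "f \<in> span E" if f: "f \<in> F" for f
  proof -
    obtain n where n: "n \<in> N" "f \<in> stab n" using f assms by auto
    obtain e where e: "e \<in> E" "e + n \<in> F" using maximal[OF N_D(1)[OF n(1)] N_D(2)[OF n(1)]] by auto
    then have "e + f \<in> E" using n by (auto simp: stab_def)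
    then have "e + (e + f) \<in> span E" using e span_add span_base by blast
    then show ?thesis by simp
  qed
  show "V \<subseteq> span E"
  proof
    fix v assume v: "v \<in> V"
    show "v \<in> span E"
    proof (cases "v \<in> F")
      case False
      then obtain e where e: "e \<in> E" "e + v \<in> F" using maximal v by auto
      then have "e + (e + v) \<in> span E" using F span_add span_base by blast
      then show ?thesis by simp
    qed (rule F)
  qed
qed

lemma decomposer_or_linear_or_lines:
  "(\<exists>D. is_decomposer D) \<or> linear_stabs scale V E F \<or> line_stabs scale V E F m \<and> span E = V"
proof (cases "\<exists>q\<in>Q. high q")
  case True
  then obtain q where q: "q \<in> Q" "high q" by auto
  then show ?thesis using decomposer_or_hyperplanes[OF q] linear_stabsI by blast
next
  case Q: False
  show ?thesis
  proof (cases "\<exists>D. is_decomposer D")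
    case False
    then have high: "\<not> high v" and F: "F = (\<Union>n\<in>N. stab n)" for v
      using decomposer_or_Union_eq_F Q by blast+
    then have QJ: "Q = F" "J = {0}" using decomposer_or_Q_eq_F False by blast+
    show ?thesis
    proof (cases "m = 2")
      case True
      have "line_stabs scale V E F m"
      proof unfold_locales
        show "stab v = {0}" if v: "v \<in> V" "v \<notin> F" "v \<notin> N" for v
        proof -
          have "low v" using v(1) by (cases rule: cases_V) (use v high in auto)
          then show ?thesis using low_outside(1) v QJ by auto
        qed
      qed (use True QJ in auto)
      then show ?thesis using span_E_if_Union[OF F] by blast
    next
      case False
      note h = hyperplanes_if_not_lines[OF high F QJ(2) False]
      have "linear_stabs scale V E F"
        by (rule linear_stabsI) (use h QJ in auto)
      then show ?thesis by blast
    qed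
  qed auto
qed

end

context maximal_disjoint_flat
begin

lemma trichotomy:
  "(\<exists>D. is_decomposer D) \<or>
    (\<forall>P. subspace P \<longrightarrow> P \<subseteq> V \<longrightarrow> card P = 8 \<longrightarrow> even (card (E \<inter> P))) \<or>
    span E = V \<and> (\<exists>A B. subspace A \<and> subspace B \<and> A \<inter> B = {0} \<and> A \<noteq> {0} \<and> B \<noteq> {0} \<and> E = A \<union> B - {0})"
proof (cases "\<forall>v\<in>V - F. \<forall>w\<in>V - F. stab v \<subseteq> stab w \<or> stab w \<subseteq> stab v")
  case True
  then show ?thesis using decomposer_if_chain by blast
next
  case False
  define I where "I = {v \<in> V - F. \<exists>w\<in>V - F. \<not> stab v \<subseteq> stab w \<and> \<not> stab w \<subseteq> stab v}"
  define m where "m = Max ((\<lambda>v. card (stab v)) ` I)"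
  have I: "finite I" "I \<noteq> {}" using finite_V False by (auto simp: I_def)
  have "m \<in> (\<lambda>v. card (stab v)) ` I" unfolding m_def by (rule Max_in) (use I in auto)
  moreover have "card (stab v) \<le> m" if "v \<in> I" for v
    unfolding m_def by (rule Max_ge) (use I that in auto)
  ultimately have "incomparable_stabs scale V E F m"
    by unfold_locales (auto simp: I_def)
  then interpret incomparable_stabs scale V E F m .
  consider "\<exists>D. is_decomposer D" | "linear_stabs scale V E F" | "line_stabs scale V E F m" "span E = V"
    using decomposer_or_linear_or_lines by blast
  then show ?thesis
  proof cases
    case 2
    then interpret linear_stabs scale V E F .
    show ?thesis using even_planes by blast
  next
    case 3
    then interpret line_stabs scale V E F m by simp
    show ?thesis using two_flats 3 by blast
  qed auto
qed

end

section \<open>Spans, bases and claws in small dimension\<close>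

context binary_space
begin

lemma finite_span: "finite B \<Longrightarrow> finite (span B)"
proof (induction rule: finite_induct)
  case (insert a B)
  have "span (insert a B) \<subseteq> span B \<union> (\<lambda>x. a + x) ` span B"
  proof
    fix x assume "x \<in> span (insert a B)"
    then obtain k where k: "x - scale k a \<in> span B" by (auto simp: span_insert)
    show "x \<in> span B \<union> (\<lambda>x. a + x) ` span B"
    proof (cases k)
      case zero
      then show ?thesis using k by simp
    next
      case one
      then have "x = a + (x - a)" "x - a \<in> span B" using k by simp_all
      then show ?thesis by blast
    qed
  qed
  then show ?case using insert finite_subset by blast
qed simp

lemma span_triple: "span {x, y, z} = {0, x, y, z, x + y, x + z, y + z, x + y + z}"
proof
  show "span {x, y, z} \<subseteq> {0, x, y, z, x + y, x + z, y + z, x + y + z}"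
    by (rule span_minimal) (auto simp: subspace_iff ac_simps)
  have "x \<in> span {x, y, z}" "y \<in> span {x, y, z}" "z \<in> span {x, y, z}" by (simp_all add: span_base)
  then show "{0, x, y, z, x + y, x + z, y + z, x + y + z} \<subseteq> span {x, y, z}"
    by (simp add: span_zero span_add)
qed

lemma span_pair: "span {x, y} = {0, x, y, x + y}"
  using span_triple[of x y y] by auto

lemma independent_pair_iff: "x \<noteq> y \<Longrightarrow> independent {x, y} \<longleftrightarrow> x \<noteq> 0 \<and> y \<noteq> 0"
  using span_pair[of y y] by (auto simp: independent_insert)

lemma independent_triple_iff:
  assumes "x \<noteq> y" "z \<noteq> x" "z \<noteq> y"
  shows "independent {z, x, y} \<longleftrightarrow> x \<noteq> 0 \<and> y \<noteq> 0 \<and> z \<notin> {0, x, y, x + y}"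
  using assms independent_pair_iff[of x y] span_pair[of x y] by (auto simp: independent_insert)

lemma vspace_flat: "subspace A \<Longrightarrow> vspace (A - {0}) = A"
  using subspace_0 by (auto simp: vspace_def)

text \<open>If the span contained no further point of \<open>E\<close>, the restriction to that
  plane would itself be a claw, with the identity as isomorphism.\<close>

lemma independent_triple_not_claw:
  assumes M: "matroid M" "claw_free M" and E: "x \<in> fst M" "y \<in> fst M" "z \<in> fst M"
    and ne: "x \<noteq> y" "x \<noteq> z" "y \<noteq> z" "z \<noteq> x + y"
  shows "x + y \<in> fst M \<or> x + z \<in> fst M \<or> y + z \<in> fst M \<or> x + y + z \<in> fst M"
proof (rule ccontr)
  assume n: "\<not> ?thesis"
  have G: "0 \<notin> snd M" "subspace (vspace (snd M))" "fst M \<subseteq> snd M"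
    using M by (auto simp: matroid_def geometry_def)
  have nz: "x \<noteq> 0" "y \<noteq> 0" "z \<noteq> 0" using E G by auto
  define P where "P = span {z, x, y}"
  have P: "P = {0, z, x, y, z + x, z + y, x + y, z + x + y}" unfolding P_def by (rule span_triple)
  have sP: "subspace P" by (simp add: P_def)
  have ind: "independent {z, x, y}" using independent_triple_iff[of x y z] ne nz by auto
  have "{z, x, y} \<subseteq> vspace (snd M)" using E G by (auto simp: vspace_def)
  then have PG: "P \<subseteq> vspace (snd M)" unfolding P_def using G(2) by (rule span_minimal)
  have flat: "flat (snd M) (P - {0})"
    using PG sP vspace_flat[OF sP] by (auto simp: flat_def vspace_def)
  have "0 \<notin> fst M" using G by auto
  then have EP: "fst M \<inter> (P - {0}) = {z, x, y}"
    using E n nz unfolding P by (auto simp: ac_simps)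
  define C where "C = ({z, x, y}, P - {0})"
  have res: "restriction M (P - {0}) = C" by (simp add: restriction_def EP C_def)
  have dim: "dim P = 3"
    unfolding P_def dim_span using dim_eq_card_independent[OF ind] ne by simp
  have "matroid C"
    unfolding matroid_def geometry_def C_def fst_conv snd_conv vspace_flat[OF sP]
    using sP nz by (auto simp: P_def span_base intro!: exI[of _ "{z, x, y}"])
  then have "claw C"
    using dim ind vspace_flat[OF sP] by (simp add: claw_def C_def P_def)
  moreover have "isomorphic C C"
    unfolding isomorphic_def by (intro exI[of _ id]) (simp add: bij_betw_id)
  ultimately show False
    using M(2) flat res unfolding claw_free_def by blast
qed

lemma two_elements_if_dim_2:
  assumes "subspace T" "dim T = 2"
  shows "\<exists>a\<in>T. \<exists>b\<in>T. a \<noteq> 0 \<and> b \<noteq> 0 \<and> a \<noteq> b"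
proof -
  obtain B where B: "B \<subseteq> T" "independent B" "card B = 2"
    using basis_exists[of T] assms(2) by metis
  then obtain a b where "B = {a, b}" "a \<noteq> b" by (metis card_2_iff)
  then show ?thesis using B independent_pair_iff by blast
qed

lemma card_eq_8_if_dim_3:
  assumes "subspace P" "dim P = 3"
  shows "card P = 8"
proof -
  obtain B where B: "B \<subseteq> P" "independent B" "P \<subseteq> span B" "card B = 3"
    using basis_exists[of P] assms(2) by metis
  then obtain z x y where zxy: "B = {z, x, y}" "z \<noteq> x" "z \<noteq> y" "x \<noteq> y" by (metis card_3_iff)
  have "P = span B" using B span_minimal[OF B(1) assms(1)] by auto
  also have "\<dots> = set [0, z, x, y, z + x, z + y, x + y, z + x + y]" by (simp add: zxy span_triple)
  finally have "P = set [0, z, x, y, z + x, z + y, x + y, z + x + y]" .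
  moreover have "distinct [0, z, x, y, z + x, z + y, x + y, z + x + y]"
    using independent_triple_iff[of x y z] B(2) zxy by (auto simp: add_eq_iff ac_simps)
  ultimately show ?thesis using distinct_card by fastforce
qed

text \<open>By finiteness a maximal \<open>F\<close> exists. If \<open>v + F\<close> missed
  \<open>E\<close>, the union of \<open>F\<close> and \<open>v + F\<close> would be a larger
  subspace disjoint from \<open>E\<close>.\<close>

lemma maximal_disjoint_subspace:
  assumes "finite V" "subspace V" and T: "subspace T" "T \<subseteq> V" "E \<inter> T = {}"
  obtains F where "subspace F" "T \<subseteq> F" "F \<subseteq> V" "E \<inter> F = {}"
    "\<And>v. v \<in> V \<Longrightarrow> v \<notin> F \<Longrightarrow> \<exists>e\<in>E. e + v \<in> F"
proof -
  let ?S = "{F. subspace F \<and> F \<subseteq> V \<and> E \<inter> F = {}}"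
  have fin: "finite ?S" by (rule finite_subset[of _ "Pow V"]) (use assms(1) in auto)
  have "T \<in> ?S" using T by simp
  from finite_has_maximal2[OF fin this]
  obtain F where FS: "F \<in> ?S" and FT: "T \<subseteq> F \<and> (\<forall>F'\<in>?S. F \<subseteq> F' \<longrightarrow> F = F')"
    by (rule bexE)
  then have F: "subspace F" "F \<subseteq> V" "E \<inter> F = {}" "T \<subseteq> F"
    and max: "\<And>F'. subspace F' \<Longrightarrow> F' \<subseteq> V \<Longrightarrow> E \<inter> F' = {} \<Longrightarrow> F \<subseteq> F' \<Longrightarrow> F = F'"
    by simp_all
  have sF: "subspace F" using F by simp
  show thesis
  proof (rule that[of F])
    fix v assume v: "v \<in> V" "v \<notin> F"
    show "\<exists>e\<in>E. e + v \<in> F"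
    proof (rule ccontr)
      assume n: "\<not> (\<exists>e\<in>E. e + v \<in> F)"
      define F' where "F' = {x \<in> V. x \<in> F \<or> x + v \<in> F}"
      have F_add: "x + y \<in> F" if "x \<in> F" "y \<in> F" for x y using that sF subspace_add by blast
      have "x + y \<in> F'" if xy: "x \<in> F'" "y \<in> F'" for x y
      proof -
        have "x + y \<in> V" using xy assms(2) subspace_add by (auto simp: F'_def)
        moreover have "x + y \<in> F \<or> x + y + v \<in> F"
          using xy F_add[of x y] F_add[of x "y + v"] F_add[of "x + v" y] F_add[of "x + v" "y + v"]
          by (auto simp: F'_def ac_simps)
        ultimately show ?thesis by (simp add: F'_def)
      qed
      then have "subspace F'"
        unfolding subspace_iff using subspace_0[OF sF] subspace_0[OF assms(2)] by (auto simp: F'_def)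
      moreover have "E \<inter> F' = {}" using n F by (auto simp: F'_def)
      moreover have "F' \<subseteq> V" "F \<subseteq> F'" using F by (auto simp: F'_def)
      ultimately have "F = F'" using max by blast
      moreover have "v \<in> F'" using v subspace_0[OF sF] by (simp add: F'_def)
      ultimately show False using v by simp
    qed
  qed (use F in auto)
qed

end

section \<open>Translation from subspaces back to flats of the matroid\<close>

theorem theorem3p1:
  fixes scale :: "bit \<Rightarrow> 'v::ab_group_add \<Rightarrow> 'v" and M :: "'v matroid"
  assumes "binary_space scale"
    and "binary_space.matroid scale M"
    and "binary_space.claw_free scale M"
  shows "binary_space.even_plane scale M \<or>
    binary_space.triangle_free scale (complement M) \<or>
    binary_space.strict_PG_sum scale M \<or>
    (\<exists>F. binary_space.decomposer scale M F)"
proof -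
  interpret binary_space scale by fact
  obtain E G where M: "M = (E, G)" by (cases M)
  define V where "V = vspace G"
  have G: "0 \<notin> G" "E \<subseteq> G" "subspace V" "finite V"
    using assms(2) by (auto simp: M V_def matroid_def geometry_def) (metis finite_span)
  have V: "V = insert 0 G" by (simp add: V_def vspace_def)
  have "even_plane M \<or> strict_PG_sum M \<or> (\<exists>F. decomposer M F)" if nt: "\<not> triangle_free (complement M)"
  proof -
    obtain T where T: "flat G T" "dim (vspace T) = 2" "T \<subseteq> G - E"
      using nt by (auto simp: triangle_free_def triangle_def complement_def M)
    then have sT: "subspace (vspace T)" "vspace T \<subseteq> V" "E \<inter> vspace T = {}"
      using V G by (auto simp: flat_def vspace_def)
    obtain F where F: "subspace F" "vspace T \<subseteq> F" "F \<subseteq> V" "E \<inter> F = {}"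
        "\<And>v. v \<in> V \<Longrightarrow> v \<notin> F \<Longrightarrow> \<exists>e\<in>E. e + v \<in> F"
      using maximal_disjoint_subspace[OF G(4,3) sT] by blast
    show ?thesis
    proof (cases "F = V")
      case True
      \<comment> \<open>An empty ground set meets every plane in zero points, an even
        number.\<close>
      then have "E = {}" using F V G by auto
      then show ?thesis by (simp add: even_plane_def M)
    next
      case False
      have no_claw: "x + y \<in> E \<or> x + z \<in> E \<or> y + z \<in> E \<or> x + y + z \<in> E"
        if "x \<in> E" "y \<in> E" "z \<in> E" "x \<noteq> y" "x \<noteq> z" "y \<noteq> z" "z \<noteq> x + y" for x y z
        using independent_triple_not_claw[OF assms(2,3), of x y z] that by (simp add: M)
      have "\<exists>a\<in>F. \<exists>b\<in>F. a \<noteq> 0 \<and> b \<noteq> 0 \<and> a \<noteq> b"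
        using two_elements_if_dim_2[OF sT(1) T(2)] F(2) by blast
      then interpret maximal_disjoint_flat scale V E F
        using G V F False no_claw by unfold_locales auto
      consider D where "is_decomposer D"
        | "\<forall>P. subspace P \<longrightarrow> P \<subseteq> V \<longrightarrow> card P = 8 \<longrightarrow> even (card (E \<inter> P))"
        | A B where "span E = V" "subspace A" "subspace B" "A \<inter> B = {0}" "A \<noteq> {0}" "B \<noteq> {0}" "E = A \<union> B - {0}"
        using trichotomy by blast
      then show ?thesis
      proof cases
        case 1
        then have D: "subspace D" "D \<subseteq> V" "D \<noteq> V" "D \<noteq> {0}"
          and inv: "\<And>x d. x \<in> V \<Longrightarrow> x \<notin> D \<Longrightarrow> d \<in> D \<Longrightarrow> x + d \<in> E \<longleftrightarrow> x \<in> E"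
          by (auto simp: is_decomposer_def)
        have "flat G (D - {0})" using D V vspace_flat by (auto simp: flat_def)
        moreover have "D - {0} \<noteq> {}" "D - {0} \<noteq> G" using D V subspace_0[OF D(1)] by auto
        moreover have "\<not> mixed M C" if "coset G (D - {0}) C" for C
          using that inv V G(1) by (auto simp: coset_def mixed_def M vspace_flat[OF D(1)])
        ultimately have "decomposer M (D - {0})" by (simp add: decomposer_def M)
        then show ?thesis by blast
      next
        case 2
        have "even (card (E \<inter> P))" if "plane G P" for P
        proof -
          have "subspace (vspace P)" "vspace P \<subseteq> V" "dim (vspace P) = 3"
            using that V by (auto simp: plane_def flat_def vspace_def)
          moreover have "E \<inter> P = E \<inter> vspace P" using G by (auto simp: vspace_def)
          ultimately show ?thesis using 2 card_eq_8_if_dim_3 by simp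
        qed
        then show ?thesis by (simp add: even_plane_def M)
      next
        case 3
        have AB: "A - {0} \<subseteq> G" "B - {0} \<subseteq> G" using 3 G by auto
        then have "flat G (A - {0})" "flat G (B - {0})"
          using 3 vspace_flat by (auto simp: flat_def)
        moreover have "A - {0} \<noteq> {}" "B - {0} \<noteq> {}" using 3 subspace_0 by blast+
        moreover have "(A - {0}) \<inter> (B - {0}) = {}" "E = (A - {0}) \<union> (B - {0})" using 3 by auto
        ultimately have "strict_PG_sum M"
          using 3(1) unfolding strict_PG_sum_def full_rank_def M fst_conv snd_conv V_def by blast
        then show ?thesis by blast
      qed
    qed
  qed
  then show ?thesis by blast
qed

end
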